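(* Let $\mathbf K$ be an algebraically closed field of characteristic zero. The operad $\mathsf{uC}$ of unital commutative algebras is not coadmissible in the category $\mathrm{Ch}(\mathbf K)$ of chain complexes over $\mathbf K$.
   Context: Chain complexes are unbounded. $\mathsf{uC}(n)=\mathbf K$ for all $n\geq0$ with trivial $\mathbf S_n$-action, so a $\mathsf{uC}$-coalgebra is a differential graded counital coassociative cocommutative coalgebra over $\mathbf K$ (no conilpotency is assumed). A dg-operad $P$ is coadmissible if the category of $P$-coalgebras in $\mathrm{Ch}(\mathbf K)$ is a model category with: weak equivalences the morphisms whose underlying chain map is a quasi-isomorphism; cofibrations the morphisms whose underlying chain map is a degree-wise monomorphism; fibrations the morphisms having the right lifting property against all maps that are both weak equivalences and cofibrations. *)

theory Defs
  imports
    "HOL-Library.Equipollence"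
    "HOL-Library.Function_Algebras"
    "HOL-Computational_Algebra.Polynomial"
begin

section \<open>Categories and model categories\<close>

record ('o, 'a) cat =
  obj :: "'o set"
  arr :: "'a set"
  dom :: "'a \<Rightarrow> 'o"
  cod :: "'a \<Rightarrow> 'o"
  ide :: "'o \<Rightarrow> 'a"
  comp :: "'a \<Rightarrow> 'a \<Rightarrow> 'a"  \<comment> \<open>\<open>comp \<C> g f\<close> is \<open>g\<close> after \<open>f\<close>\<close>

definition hom :: "('o, 'a) cat \<Rightarrow> 'o \<Rightarrow> 'o \<Rightarrow> 'a set" where
  "hom \<C> X Y = {f \<in> arr \<C>. dom \<C> f = X \<and> cod \<C> f = Y}"

definition category :: "('o, 'a) cat \<Rightarrow> bool" where
  "category \<C> \<longleftrightarrow>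
     (\<forall>f\<in>arr \<C>. dom \<C> f \<in> obj \<C> \<and> cod \<C> f \<in> obj \<C>) \<and>
     (\<forall>X\<in>obj \<C>. ide \<C> X \<in> hom \<C> X X) \<and>
     (\<forall>f\<in>arr \<C>. \<forall>g\<in>arr \<C>. cod \<C> f = dom \<C> g \<longrightarrow> comp \<C> g f \<in> hom \<C> (dom \<C> f) (cod \<C> g)) \<and>
     (\<forall>f\<in>arr \<C>. comp \<C> f (ide \<C> (dom \<C> f)) = f \<and> comp \<C> (ide \<C> (cod \<C> f)) f = f) \<and>
     (\<forall>f\<in>arr \<C>. \<forall>g\<in>arr \<C>. \<forall>h\<in>arr \<C>. cod \<C> f = dom \<C> g \<longrightarrow> cod \<C> g = dom \<C> h \<longrightarrow>
        comp \<C> h (comp \<C> g f) = comp \<C> (comp \<C> h g) f)"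

definition opposite :: "('o, 'a) cat \<Rightarrow> ('o, 'a) cat" where
  "opposite \<C> = \<lparr>obj = obj \<C>, arr = arr \<C>, dom = cod \<C>, cod = dom \<C>,
                ide = ide \<C>, comp = (\<lambda>g f. comp \<C> f g)\<rparr>"

definition is_functor ::
  "('j, 'b) cat \<Rightarrow> ('o, 'a) cat \<Rightarrow> ('j \<Rightarrow> 'o) \<Rightarrow> ('b \<Rightarrow> 'a) \<Rightarrow> bool" where
  "is_functor \<J> \<C> F\<^sub>o F\<^sub>a \<longleftrightarrow>
     (\<forall>j\<in>obj \<J>. F\<^sub>o j \<in> obj \<C>) \<and>
     (\<forall>u\<in>arr \<J>. F\<^sub>a u \<in> hom \<C> (F\<^sub>o (dom \<J> u)) (F\<^sub>o (cod \<J> u))) \<and>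
     (\<forall>j\<in>obj \<J>. F\<^sub>a (ide \<J> j) = ide \<C> (F\<^sub>o j)) \<and>
     (\<forall>u\<in>arr \<J>. \<forall>v\<in>arr \<J>. cod \<J> u = dom \<J> v \<longrightarrow>
        F\<^sub>a (comp \<J> v u) = comp \<C> (F\<^sub>a v) (F\<^sub>a u))"

definition is_cone ::
  "('j, 'b) cat \<Rightarrow> ('o, 'a) cat \<Rightarrow> ('j \<Rightarrow> 'o) \<Rightarrow> ('b \<Rightarrow> 'a) \<Rightarrow> 'o \<Rightarrow> ('j \<Rightarrow> 'a) \<Rightarrow> bool" where
  "is_cone \<J> \<C> F\<^sub>o F\<^sub>a X \<pi> \<longleftrightarrow>
     X \<in> obj \<C> \<and> (\<forall>j\<in>obj \<J>. \<pi> j \<in> hom \<C> X (F\<^sub>o j)) \<and>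
     (\<forall>u\<in>arr \<J>. comp \<C> (F\<^sub>a u) (\<pi> (dom \<J> u)) = \<pi> (cod \<J> u))"

definition is_limit ::
  "('j, 'b) cat \<Rightarrow> ('o, 'a) cat \<Rightarrow> ('j \<Rightarrow> 'o) \<Rightarrow> ('b \<Rightarrow> 'a) \<Rightarrow> 'o \<Rightarrow> ('j \<Rightarrow> 'a) \<Rightarrow> bool" where
  "is_limit \<J> \<C> F\<^sub>o F\<^sub>a L \<pi> \<longleftrightarrow> is_cone \<J> \<C> F\<^sub>o F\<^sub>a L \<pi> \<and>
     (\<forall>X \<rho>. is_cone \<J> \<C> F\<^sub>o F\<^sub>a X \<rho> \<longrightarrow>
        (\<exists>!h. h \<in> hom \<C> X L \<and> (\<forall>j\<in>obj \<J>. comp \<C> (\<pi> j) h = \<rho> j)))"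

text \<open>Every finite category is isomorphic to one whose objects and arrows are natural numbers.\<close>

definition has_finite_limits :: "('o, 'a) cat \<Rightarrow> bool" where
  "has_finite_limits \<C> \<longleftrightarrow>
     (\<forall>(\<J> :: (nat, nat) cat) F\<^sub>o F\<^sub>a. category \<J> \<longrightarrow> finite (obj \<J>) \<longrightarrow> finite (arr \<J>) \<longrightarrow>
        is_functor \<J> \<C> F\<^sub>o F\<^sub>a \<longrightarrow> (\<exists>L \<pi>. is_limit \<J> \<C> F\<^sub>o F\<^sub>a L \<pi>))"

definition has_finite_colimits :: "('o, 'a) cat \<Rightarrow> bool" where
  "has_finite_colimits \<C> \<longleftrightarrow> has_finite_limits (opposite \<C>)"

text \<open>\<open>i\<close> has the left lifting property against \<open>p\<close> (equivalently, \<open>p\<close> the right lifting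
  property against \<open>i\<close>).\<close>

definition lifts :: "('o, 'a) cat \<Rightarrow> 'a \<Rightarrow> 'a \<Rightarrow> bool" where
  "lifts \<C> i p \<longleftrightarrow>
     (\<forall>u v. u \<in> hom \<C> (dom \<C> i) (dom \<C> p) \<longrightarrow> v \<in> hom \<C> (cod \<C> i) (cod \<C> p) \<longrightarrow>
        comp \<C> p u = comp \<C> v i \<longrightarrow>
        (\<exists>h \<in> hom \<C> (cod \<C> i) (dom \<C> p). comp \<C> h i = u \<and> comp \<C> p h = v))"

definition rlp :: "('o, 'a) cat \<Rightarrow> 'a set \<Rightarrow> 'a set" where
  "rlp \<C> I = {p \<in> arr \<C>. \<forall>i\<in>I. lifts \<C> i p}"

definition retract_of :: "('o, 'a) cat \<Rightarrow> 'a \<Rightarrow> 'a \<Rightarrow> bool" where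
  "retract_of \<C> f g \<longleftrightarrow>
     (\<exists>s \<in> hom \<C> (dom \<C> f) (dom \<C> g). \<exists>r \<in> hom \<C> (dom \<C> g) (dom \<C> f).
      \<exists>s' \<in> hom \<C> (cod \<C> f) (cod \<C> g). \<exists>r' \<in> hom \<C> (cod \<C> g) (cod \<C> f).
        comp \<C> r s = ide \<C> (dom \<C> f) \<and> comp \<C> r' s' = ide \<C> (cod \<C> f) \<and>
        comp \<C> g s = comp \<C> s' f \<and> comp \<C> f r = comp \<C> r' g)"

definition retract_closed :: "('o, 'a) cat \<Rightarrow> 'a set \<Rightarrow> bool" where
  "retract_closed \<C> S \<longleftrightarrow> (\<forall>f\<in>arr \<C>. \<forall>g\<in>S. retract_of \<C> f g \<longrightarrow> f \<in> S)"

definition two_out_of_three :: "('o, 'a) cat \<Rightarrow> 'a set \<Rightarrow> bool" where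
  "two_out_of_three \<C> W \<longleftrightarrow>
     (\<forall>f\<in>arr \<C>. \<forall>g\<in>arr \<C>. cod \<C> f = dom \<C> g \<longrightarrow>
        (f \<in> W \<and> g \<in> W \<longrightarrow> comp \<C> g f \<in> W) \<and>
        (f \<in> W \<and> comp \<C> g f \<in> W \<longrightarrow> g \<in> W) \<and>
        (g \<in> W \<and> comp \<C> g f \<in> W \<longrightarrow> f \<in> W))"

definition factorizes :: "('o, 'a) cat \<Rightarrow> 'a set \<Rightarrow> 'a set \<Rightarrow> bool" where
  "factorizes \<C> I P \<longleftrightarrow>
     (\<forall>f\<in>arr \<C>. \<exists>i\<in>I. \<exists>p\<in>P. cod \<C> i = dom \<C> p \<and> comp \<C> p i = f)"

text \<open>Quillen's closed model categories: only finite limits and colimits and non-functorial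
  factorizations are demanded.\<close>

definition model_category :: "('o, 'a) cat \<Rightarrow> 'a set \<Rightarrow> 'a set \<Rightarrow> 'a set \<Rightarrow> bool" where
  "model_category \<C> W Cof Fib \<longleftrightarrow>
     category \<C> \<and> W \<subseteq> arr \<C> \<and> Cof \<subseteq> arr \<C> \<and> Fib \<subseteq> arr \<C> \<and>
     has_finite_limits \<C> \<and> has_finite_colimits \<C> \<and>
     two_out_of_three \<C> W \<and>
     retract_closed \<C> W \<and> retract_closed \<C> Cof \<and> retract_closed \<C> Fib \<and>
     (\<forall>i \<in> Cof \<inter> W. \<forall>p \<in> Fib. lifts \<C> i p) \<and>
     (\<forall>i \<in> Cof. \<forall>p \<in> Fib \<inter> W. lifts \<C> i p) \<and>
     factorizes \<C> (Cof \<inter> W) Fib \<and> factorizes \<C> Cof (Fib \<inter> W)"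


section \<open>Vector spaces and tensor products\<close>

text \<open>
  Vector spaces over \<open>'k\<close> are linear subspaces of coordinate spaces \<open>'a \<Rightarrow> 'k\<close> with the pointwise
  operations. Up to isomorphism, these are the vector spaces of dimension at most
  that of \<open>'a \<Rightarrow> 'k\<close>.
\<close>

definition fscale :: "'k::field \<Rightarrow> ('a \<Rightarrow> 'k) \<Rightarrow> ('a \<Rightarrow> 'k)" where
  "fscale c v = (\<lambda>x. c * v x)"

global_interpretation fvs: vector_space "fscale :: 'k::field \<Rightarrow> ('a \<Rightarrow> 'k) \<Rightarrow> ('a \<Rightarrow> 'k)"
  by unfold_locales (auto simp: fscale_def fun_eq_iff algebra_simps)

text \<open>The maps below are normalized to vanish outside their domain \<open>V\<close>, so that equality of
  functions is equality of linear maps on \<open>V\<close>.\<close>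

definition linear_on :: "('a \<Rightarrow> 'k::field) set \<Rightarrow> (('a \<Rightarrow> 'k) \<Rightarrow> ('b \<Rightarrow> 'k)) \<Rightarrow> bool" where
  "linear_on V f \<longleftrightarrow>
     (\<forall>v\<in>V. \<forall>w\<in>V. f (v + w) = f v + f w) \<and> (\<forall>c. \<forall>v\<in>V. f (fscale c v) = fscale c (f v)) \<and>
     (\<forall>v. v \<notin> V \<longrightarrow> f v = 0)"

definition functional_on :: "('a \<Rightarrow> 'k::field) set \<Rightarrow> (('a \<Rightarrow> 'k) \<Rightarrow> 'k) \<Rightarrow> bool" where
  "functional_on V e \<longleftrightarrow>
     (\<forall>v\<in>V. \<forall>w\<in>V. e (v + w) = e v + e w) \<and> (\<forall>c. \<forall>v\<in>V. e (fscale c v) = c * e v) \<and>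
     (\<forall>v. v \<notin> V \<longrightarrow> e v = 0)"

text \<open>
  For subspaces \<open>V\<close> of \<open>'a \<Rightarrow> 'k\<close> and \<open>W\<close> of \<open>'b \<Rightarrow> 'k\<close>, the canonical map from the tensor product
  of \<open>V\<close> and \<open>W\<close> to \<open>'a \<times> 'b \<Rightarrow> 'k\<close>, sending the tensor of \<open>v\<close> and \<open>w\<close> to
  \<open>\<lambda>(x, y). v x * w y\<close>, is injective. We identify the tensor product with its image.
\<close>

definition tensor :: "('a \<Rightarrow> 'k::field) \<Rightarrow> ('b \<Rightarrow> 'k) \<Rightarrow> ('a \<times> 'b \<Rightarrow> 'k)" where
  "tensor v w = (\<lambda>(x, y). v x * w y)"

definition tensor_space ::
  "('a \<Rightarrow> 'k::field) set \<Rightarrow> ('b \<Rightarrow> 'k) set \<Rightarrow> ('a \<times> 'b \<Rightarrow> 'k) set" where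
  "tensor_space V W = fvs.span {tensor v w | v w. v \<in> V \<and> w \<in> W}"

text \<open>
  If \<open>t\<close> lies in \<open>tensor_space V W\<close>, then its columns \<open>\<lambda>x. t (x, y)\<close> lie in \<open>V\<close> and its rows
  \<open>\<lambda>y. t (x, y)\<close> lie in \<open>W\<close>. Hence the tensor products \<open>f \<otimes> id\<close> and \<open>id \<otimes> g\<close> of linear maps
  with identities act by applying \<open>f\<close> to the columns and \<open>g\<close> to the rows; see the lemmas
  \<open>map_left_tensor\<close> to \<open>contract_right_tensor\<close> for the values on elementary tensors.
\<close>

definition map_left :: "(('a \<Rightarrow> 'k) \<Rightarrow> ('c \<Rightarrow> 'k)) \<Rightarrow> ('a \<times> 'b \<Rightarrow> 'k) \<Rightarrow> ('c \<times> 'b \<Rightarrow> 'k)" where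
  "map_left f t = (\<lambda>(z, y). f (\<lambda>x. t (x, y)) z)"

definition map_right :: "(('b \<Rightarrow> 'k) \<Rightarrow> ('c \<Rightarrow> 'k)) \<Rightarrow> ('a \<times> 'b \<Rightarrow> 'k) \<Rightarrow> ('a \<times> 'c \<Rightarrow> 'k)" where
  "map_right g t = (\<lambda>(x, z). g (\<lambda>y. t (x, y)) z)"

definition contract_left :: "(('a \<Rightarrow> 'k) \<Rightarrow> 'k) \<Rightarrow> ('a \<times> 'b \<Rightarrow> 'k) \<Rightarrow> ('b \<Rightarrow> 'k)" where
  "contract_left e t = (\<lambda>y. e (\<lambda>x. t (x, y)))"

definition contract_right :: "(('b \<Rightarrow> 'k) \<Rightarrow> 'k) \<Rightarrow> ('a \<times> 'b \<Rightarrow> 'k) \<Rightarrow> ('a \<Rightarrow> 'k)" where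
  "contract_right e t = (\<lambda>x. e (\<lambda>y. t (x, y)))"

definition reassoc :: "(('a \<times> 'b) \<times> 'c \<Rightarrow> 'k) \<Rightarrow> ('a \<times> ('b \<times> 'c) \<Rightarrow> 'k)" where
  "reassoc t = (\<lambda>(x, y, z). t ((x, y), z))"

definition swap :: "('a \<times> 'b \<Rightarrow> 'k) \<Rightarrow> ('b \<times> 'a \<Rightarrow> 'k)" where
  "swap t = (\<lambda>(y, x). t (x, y))"

lemma map_left_tensor:
  assumes "linear_on V f" "v \<in> V"
  shows "map_left f (tensor v w) = tensor (f v) w"
proof -
  have eq: "(\<lambda>x. v x * w y) = fscale (w y) v" for y
    by (simp add: fscale_def mult.commute)
  show ?thesis
    using assms
    by (simp add: map_left_def tensor_def eq linear_on_def) (simp add: fscale_def mult.commute)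
qed

lemma map_right_tensor:
  assumes "linear_on W g" "w \<in> W"
  shows "map_right g (tensor v w) = tensor v (g w)"
proof -
  have eq: "(\<lambda>y. v x * w y) = fscale (v x) w" for x
    by (simp add: fscale_def)
  show ?thesis
    using assms by (simp add: map_right_def tensor_def eq linear_on_def) (simp add: fscale_def)
qed

lemma contract_left_tensor:
  assumes "functional_on V e" "v \<in> V"
  shows "contract_left e (tensor v w) = fscale (e v) w"
proof -
  have eq: "(\<lambda>x. v x * w y) = fscale (w y) v" for y
    by (simp add: fscale_def mult.commute)
  show ?thesis
    using assms
    by (simp add: contract_left_def tensor_def eq functional_on_def) (simp add: fscale_def mult.commute)
qed

lemma contract_right_tensor:
  assumes "functional_on W e" "w \<in> W"
  shows "contract_right e (tensor v w) = fscale (e w) v"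
proof -
  have eq: "(\<lambda>y. v x * w y) = fscale (v x) w" for x
    by (simp add: fscale_def)
  show ?thesis
    using assms
    by (simp add: contract_right_def tensor_def eq functional_on_def) (simp add: fscale_def mult.commute)
qed

lemma tensor_space_induct [consumes 1, case_names zero tensor add]:
  assumes "t \<in> tensor_space V W"
    and "P 0"
    and "\<And>c v w. v \<in> V \<Longrightarrow> w \<in> W \<Longrightarrow> P (fscale c (tensor v w))"
    and "\<And>s t. s \<in> tensor_space V W \<Longrightarrow> t \<in> tensor_space V W \<Longrightarrow> P s \<Longrightarrow> P t \<Longrightarrow> P (s + t)"
  shows "P t"
proof -
  have "t \<in> tensor_space V W \<and> P t"
    using assms(1) unfolding tensor_space_def
  proof (induction rule: fvs.span_induct_alt)
    case base
    then show ?case using assms(2) fvs.span_zero by blast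
  next
    case (step c x y)
    then have "fscale c x \<in> fvs.span {tensor v w | v w. v \<in> V \<and> w \<in> W}"
      by (intro fvs.span_scale fvs.span_base)
    moreover have "P (fscale c x)"
      using step assms(3) by auto
    ultimately show ?case
      using step.IH step.hyps assms(4)[unfolded tensor_space_def] fvs.span_add by blast
  qed
  then show ?thesis by simp
qed

lemma fscale_tensor: "fscale c (tensor v w) = tensor (fscale c v) w"
  by (auto simp: fscale_def tensor_def fun_eq_iff mult.assoc)

lemma column_in:
  assumes "t \<in> tensor_space V W" "fvs.subspace V"
  shows "(\<lambda>x. t (x, y)) \<in> V"
  using assms(1)
proof (induction rule: tensor_space_induct)
  case zero
  then show ?case using fvs.subspace_0[OF assms(2)] by (simp add: zero_fun_def)
next
  case (tensor c v w)
  have "(\<lambda>x. fscale c (tensor v w) (x, y)) = fscale (c * w y) v"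
    by (auto simp: fscale_def tensor_def fun_eq_iff algebra_simps)
  then show ?case using tensor fvs.subspace_scale[OF assms(2)] by simp
next
  case (add s t)
  then show ?case using fvs.subspace_add[OF assms(2) add(3,4)] by (simp add: plus_fun_def)
qed

lemma row_in:
  assumes "t \<in> tensor_space V W" "fvs.subspace W"
  shows "(\<lambda>y. t (x, y)) \<in> W"
  using assms(1)
proof (induction rule: tensor_space_induct)
  case zero
  then show ?case using fvs.subspace_0[OF assms(2)] by (simp add: zero_fun_def)
next
  case (tensor c v w)
  have "(\<lambda>y. fscale c (tensor v w) (x, y)) = fscale (c * v x) w"
    by (auto simp: fscale_def tensor_def fun_eq_iff algebra_simps)
  then show ?case using tensor fvs.subspace_scale[OF assms(2)] by simp
next
  case (add s t)
  then show ?case using fvs.subspace_add[OF assms(2) add(3,4)] by (simp add: plus_fun_def)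
qed

lemma linear_on_add: "linear_on V f \<Longrightarrow> v \<in> V \<Longrightarrow> w \<in> V \<Longrightarrow> f (v + w) = f v + f w"
  by (simp add: linear_on_def)

lemma linear_on_scale: "linear_on V f \<Longrightarrow> v \<in> V \<Longrightarrow> f (fscale c v) = fscale c (f v)"
  by (simp add: linear_on_def)

lemma linear_on_outside: "linear_on V f \<Longrightarrow> v \<notin> V \<Longrightarrow> f v = 0"
  by (simp add: linear_on_def)

lemma linear_on_0: "fvs.subspace V \<Longrightarrow> linear_on V f \<Longrightarrow> f 0 = 0"
  using fvs.subspace_0[of V] unfolding linear_on_def by (metis fvs.scale_zero_left)

lemma map_left_0:
  assumes "fvs.subspace V" "linear_on V f"
  shows "map_left f 0 = 0"
  using linear_on_0[OF assms] by (auto simp: map_left_def fun_eq_iff zero_fun_def)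

lemma map_right_0:
  assumes "fvs.subspace W" "linear_on W g"
  shows "map_right g 0 = 0"
  using linear_on_0[OF assms] by (auto simp: map_right_def fun_eq_iff zero_fun_def)

lemma map_left_add:
  assumes "fvs.subspace V" "linear_on V f" "s \<in> tensor_space V W" "t \<in> tensor_space V W"
  shows "map_left f (s + t) = map_left f s + map_left f t"
proof -
  have "f (\<lambda>x. (s + t) (x, y)) = f (\<lambda>x. s (x, y)) + f (\<lambda>x. t (x, y))" for y
  proof -
    have "(\<lambda>x. (s + t) (x, y)) = (\<lambda>x. s (x, y)) + (\<lambda>x. t (x, y))"
      by auto
    then show ?thesis
      using linear_on_add[OF assms(2) column_in[OF assms(3,1)] column_in[OF assms(4,1)]] by (simp only:)
  qed
  from fun_cong[OF this] show ?thesis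
    by (auto simp: map_left_def intro!: ext)
qed

lemma map_right_add:
  assumes "fvs.subspace W" "linear_on W g" "s \<in> tensor_space V W" "t \<in> tensor_space V W"
  shows "map_right g (s + t) = map_right g s + map_right g t"
proof -
  have "g (\<lambda>y. (s + t) (x, y)) = g (\<lambda>y. s (x, y)) + g (\<lambda>y. t (x, y))" for x
  proof -
    have "(\<lambda>y. (s + t) (x, y)) = (\<lambda>y. s (x, y)) + (\<lambda>y. t (x, y))"
      by auto
    then show ?thesis
      using linear_on_add[OF assms(2) row_in[OF assms(3,1)] row_in[OF assms(4,1)]] by (simp only:)
  qed
  from fun_cong[OF this] show ?thesis
    by (auto simp: map_right_def intro!: ext)
qed

lemma tensor_in: "v \<in> V \<Longrightarrow> w \<in> W \<Longrightarrow> tensor v w \<in> tensor_space V W"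
  unfolding tensor_space_def by (intro fvs.span_base) auto

lemma subspace_tensor_space: "fvs.subspace (tensor_space V W)"
  by (simp add: tensor_space_def)

lemma map_left_in:
  assumes "fvs.subspace V" "linear_on V f" "\<forall>v\<in>V. f v \<in> V'" "t \<in> tensor_space V W"
  shows "map_left f t \<in> tensor_space V' W"
  using assms(4)
proof (induction rule: tensor_space_induct)
  case zero
  then show ?case
    using fvs.subspace_0[OF subspace_tensor_space] by (metis map_left_0[OF assms(1,2)])
next
  case (tensor c v w)
  then have "fscale c v \<in> V" using fvs.subspace_scale[OF assms(1)] by blast
  then show ?case
    using tensor assms(3) by (simp add: fscale_tensor map_left_tensor[OF assms(2)] tensor_in)
next
  case (add s t)
  then show ?case
    using fvs.subspace_add[OF subspace_tensor_space add(3,4)]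
    unfolding map_left_add[OF assms(1,2) add(1,2)] by blast
qed

lemma map_right_in:
  assumes "fvs.subspace W" "linear_on W g" "\<forall>w\<in>W. g w \<in> W'" "t \<in> tensor_space V W"
    and "fvs.subspace V"
  shows "map_right g t \<in> tensor_space V W'"
  using assms(4)
proof (induction rule: tensor_space_induct)
  case zero
  then show ?case
    using fvs.subspace_0[OF subspace_tensor_space] by (metis map_right_0[OF assms(1,2)])
next
  case (tensor c v w)
  then have "fscale c v \<in> V" using fvs.subspace_scale[OF assms(5)] by blast
  then show ?case
    using tensor assms(3) by (simp add: fscale_tensor map_right_tensor[OF assms(2)] tensor_in)
next
  case (add s t)
  then show ?case
    using fvs.subspace_add[OF subspace_tensor_space add(3,4)]
    unfolding map_right_add[OF assms(1,2) add(1,2)] by blast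
qed

lemma map_left_right:
  assumes V: "fvs.subspace V" "linear_on V f" "\<forall>v\<in>V. f v \<in> V'"
    and W: "fvs.subspace W" "linear_on W g" "\<forall>w\<in>W. g w \<in> W'"
    and "t \<in> tensor_space V W"
  shows "map_left f (map_right g t) = map_right g (map_left f t)"
  using assms(7)
proof (induction rule: tensor_space_induct)
  case zero
  then show ?case by (metis map_left_0[OF V(1,2)] map_right_0[OF W(1,2)])
next
  case (tensor c v w)
  then have "fscale c v \<in> V" using fvs.subspace_scale[OF V(1)] by blast
  then show ?case
    using tensor by (simp add: fscale_tensor map_left_tensor[OF V(2)] map_right_tensor[OF W(2)])
next
  case (add s t)
  show ?case
    unfolding map_right_add[OF W(1,2) add(1,2)] map_left_add[OF V(1,2) add(1,2)]
    unfolding map_left_add[OF V(1,2) map_right_in[OF W add(1) V(1)] map_right_in[OF W add(2) V(1)]]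
      map_right_add[OF W(1,2) map_left_in[OF V add(1)] map_left_in[OF V add(2)]]
    unfolding add(3,4)
    by (rule refl)
qed


section \<open>Chain complexes\<close>

record ('u, 'k) complex_data =
  spc :: "int \<Rightarrow> ('u \<Rightarrow> 'k) set"
  dif :: "int \<Rightarrow> ('u \<Rightarrow> 'k) \<Rightarrow> ('u \<Rightarrow> 'k)"

text \<open>
  The type \<open>'u\<close> plays the role of the set-theoretic universe: a set is small if its cardinality is
  strictly less than that of \<open>'u\<close>. When \<open>'u\<close> has more elements than \<open>'k\<close>, every small vector space
  has a small basis and hence is isomorphic to a small subspace of \<open>'u \<Rightarrow> 'k\<close>.
\<close>

definition chain_complex :: "('u, 'k::field, 'x) complex_data_scheme \<Rightarrow> bool" where
  "chain_complex C \<longleftrightarrow>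
     (\<forall>n. fvs.subspace (spc C n) \<and> spc C n \<prec> (UNIV :: 'u set) \<and>
          linear_on (spc C n) (dif C n) \<and>
          (\<forall>v\<in>spc C n. dif C n v \<in> spc C (n - 1) \<and> dif C (n - 1) (dif C n v) = 0))"

definition chain_map ::
  "('u, 'k::field, 'x) complex_data_scheme \<Rightarrow> ('u, 'k, 'x) complex_data_scheme \<Rightarrow>
   (int \<Rightarrow> ('u \<Rightarrow> 'k) \<Rightarrow> ('u \<Rightarrow> 'k)) \<Rightarrow> bool" where
  "chain_map C D f \<longleftrightarrow>
     (\<forall>n. linear_on (spc C n) (f n) \<and>
          (\<forall>v\<in>spc C n. f n v \<in> spc D n \<and> f (n - 1) (dif C n v) = dif D n (f n v)))"

definition cycles :: "('u, 'k::field, 'x) complex_data_scheme \<Rightarrow> int \<Rightarrow> ('u \<Rightarrow> 'k) set" where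
  "cycles C n = {z \<in> spc C n. dif C n z = 0}"

definition boundaries :: "('u, 'k::field, 'x) complex_data_scheme \<Rightarrow> int \<Rightarrow> ('u \<Rightarrow> 'k) set" where
  "boundaries C n = dif C (n + 1) ` spc C (n + 1)"

definition homology_class ::
  "('u, 'k::field, 'x) complex_data_scheme \<Rightarrow> int \<Rightarrow> ('u \<Rightarrow> 'k) \<Rightarrow> ('u \<Rightarrow> 'k) set" where
  "homology_class C n z = {z + b | b. b \<in> boundaries C n}"

definition homology ::
  "('u, 'k::field, 'x) complex_data_scheme \<Rightarrow> int \<Rightarrow> ('u \<Rightarrow> 'k) set set" where
  "homology C n = homology_class C n ` cycles C n"

definition homology_map ::
  "('u, 'k::field, 'x) complex_data_scheme \<Rightarrow> (int \<Rightarrow> ('u \<Rightarrow> 'k) \<Rightarrow> ('u \<Rightarrow> 'k)) \<Rightarrow>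
   int \<Rightarrow> ('u \<Rightarrow> 'k) set \<Rightarrow> ('u \<Rightarrow> 'k) set" where
  "homology_map D f n X = (\<Union>z\<in>X. homology_class D n (f n z))"

definition quasi_iso ::
  "('u, 'k::field, 'x) complex_data_scheme \<Rightarrow> ('u, 'k, 'x) complex_data_scheme \<Rightarrow>
   (int \<Rightarrow> ('u \<Rightarrow> 'k) \<Rightarrow> ('u \<Rightarrow> 'k)) \<Rightarrow> bool" where
  "quasi_iso C D f \<longleftrightarrow> (\<forall>n. bij_betw (homology_map D f n) (homology C n) (homology D n))"

text \<open>An element of degree \<open>n\<close> of the tensor product of two complexes is the family \<open>t\<close> of its
  components \<open>t p q\<close> of bidegree \<open>(p, q)\<close>, where \<open>p + q = n\<close>.\<close>

definition tensor_deg ::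
  "('u, 'k::field, 'x) complex_data_scheme \<Rightarrow> ('u, 'k, 'x) complex_data_scheme \<Rightarrow> int \<Rightarrow>
   (int \<Rightarrow> int \<Rightarrow> 'u \<times> 'u \<Rightarrow> 'k) set" where
  "tensor_deg C D n =
     {t. (\<forall>p q. t p q \<in> tensor_space (spc C p) (spc D q)) \<and>
         (\<forall>p q. p + q \<noteq> n \<longrightarrow> t p q = 0) \<and> finite {(p, q). t p q \<noteq> 0}}"

definition koszul :: "int \<Rightarrow> 'k::field" where
  "koszul n = (if even n then 1 else - 1)"

text \<open>The differential sends the tensor of \<open>v\<close> and \<open>w\<close>, with \<open>v\<close> of degree \<open>p\<close>, to
  \<open>dv \<otimes> w + (-1)^p v \<otimes> dw\<close>.\<close>

definition tensor_dif ::
  "('u, 'k::field, 'x) complex_data_scheme \<Rightarrow> ('u, 'k, 'x) complex_data_scheme \<Rightarrow>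
   (int \<Rightarrow> int \<Rightarrow> 'u \<times> 'u \<Rightarrow> 'k) \<Rightarrow> (int \<Rightarrow> int \<Rightarrow> 'u \<times> 'u \<Rightarrow> 'k)" where
  "tensor_dif C D t =
     (\<lambda>p q. map_left (dif C (p + 1)) (t (p + 1) q) +
            fscale (koszul p) (map_right (dif D (q + 1)) (t p (q + 1))))"

definition tensor_map ::
  "(int \<Rightarrow> ('u \<Rightarrow> 'k) \<Rightarrow> ('u \<Rightarrow> 'k)) \<Rightarrow> (int \<Rightarrow> ('u \<Rightarrow> 'k) \<Rightarrow> ('u \<Rightarrow> 'k)) \<Rightarrow>
   (int \<Rightarrow> int \<Rightarrow> 'u \<times> 'u \<Rightarrow> 'k) \<Rightarrow> (int \<Rightarrow> int \<Rightarrow> 'u \<times> 'u \<Rightarrow> 'k)" where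
  "tensor_map f g t = (\<lambda>p q. map_left (f p) (map_right (g q) (t p q)))"


section \<open>Coalgebras over the operad \<open>uC\<close>\<close>

text \<open>Since \<open>uC(n) = 'k\<close> with trivial action for all \<open>n \<ge> 0\<close>, a \<open>uC\<close>-coalgebra is a differential graded
  counital coassociative cocommutative coalgebra; no conilpotency is assumed.
  \<open>comul C n c p q\<close> is the component of bidegree \<open>(p, q)\<close> of the comultiplication of the element
  \<open>c\<close> of degree \<open>n\<close>; the counit, a chain map to \<open>'k\<close> concentrated in degree 0, is given by its
  degree 0 component.\<close>

record ('u, 'k) coalgebra_data = "('u, 'k) complex_data" +
  comul :: "int \<Rightarrow> ('u \<Rightarrow> 'k) \<Rightarrow> int \<Rightarrow> int \<Rightarrow> ('u \<times> 'u \<Rightarrow> 'k)"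
  counit :: "('u \<Rightarrow> 'k) \<Rightarrow> 'k"

definition uC_coalgebra :: "('u, 'k::field) coalgebra_data \<Rightarrow> bool" where
  "uC_coalgebra C \<longleftrightarrow>
     chain_complex C \<and>
     \<comment> \<open>the comultiplication is a chain map\<close>
     (\<forall>n p q. linear_on (spc C n) (\<lambda>c. comul C n c p q)) \<and>
     (\<forall>n. \<forall>c\<in>spc C n. comul C n c \<in> tensor_deg C C n \<and>
        comul C (n - 1) (dif C n c) = tensor_dif C C (comul C n c)) \<and>
     \<comment> \<open>the counit is a chain map\<close>
     functional_on (spc C 0) (counit C) \<and> (\<forall>c\<in>spc C 1. counit C (dif C 1 c) = 0) \<and>
     \<comment> \<open>coassociativity, in tridegree \<open>(p, q, r)\<close>\<close>
     (\<forall>n p q r. \<forall>c\<in>spc C n.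
        reassoc (map_left (\<lambda>v. comul C (p + q) v p q) (comul C n c (p + q) r)) =
        map_right (\<lambda>v. comul C (q + r) v q r) (comul C n c p (q + r))) \<and>
     \<comment> \<open>counitality\<close>
     (\<forall>n. \<forall>c\<in>spc C n. contract_left (counit C) (comul C n c 0 n) = c \<and>
                      contract_right (counit C) (comul C n c n 0) = c) \<and>
     \<comment> \<open>cocommutativity, with the Koszul sign\<close>
     (\<forall>n p q. \<forall>c\<in>spc C n. comul C n c q p = fscale (koszul (p * q)) (swap (comul C n c p q)))"

definition coalgebra_map ::
  "('u, 'k::field) coalgebra_data \<Rightarrow> ('u, 'k) coalgebra_data \<Rightarrow>
   (int \<Rightarrow> ('u \<Rightarrow> 'k) \<Rightarrow> ('u \<Rightarrow> 'k)) \<Rightarrow> bool" where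
  "coalgebra_map C D f \<longleftrightarrow>
     chain_map C D f \<and>
     (\<forall>n. \<forall>c\<in>spc C n. comul D n (f n c) = tensor_map f f (comul C n c)) \<and>
     (\<forall>c\<in>spc C 0. counit D (f 0 c) = counit C c)"

record ('c, 'm) arrow =
  src :: 'c
  fn :: 'm
  trg :: 'c

type_synonym ('u, 'k, 'x) complex_arrow =
  "(('u, 'k, 'x) complex_data_scheme, int \<Rightarrow> ('u \<Rightarrow> 'k) \<Rightarrow> ('u \<Rightarrow> 'k)) arrow"

definition uC_Coalg ::
  "(('u, 'k::field) coalgebra_data,
    (('u, 'k) coalgebra_data, int \<Rightarrow> ('u \<Rightarrow> 'k) \<Rightarrow> ('u \<Rightarrow> 'k)) arrow) cat" where
  "uC_Coalg =
     \<lparr>obj = {C. uC_coalgebra C},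
      arr = {f. uC_coalgebra (src f) \<and> uC_coalgebra (trg f) \<and>
                coalgebra_map (src f) (trg f) (fn f)},
      dom = src, cod = trg,
      ide = (\<lambda>C. \<lparr>src = C, fn = (\<lambda>n v. if v \<in> spc C n then v else 0), trg = C\<rparr>),
      comp = (\<lambda>g f. \<lparr>src = src f, fn = (\<lambda>n v. fn g n (fn f n v)), trg = trg g\<rparr>)\<rparr>"


lemma linear_on_ide:
  assumes "fvs.subspace V"
  shows "linear_on V (\<lambda>v. if v \<in> V then v else 0)"
  unfolding linear_on_def
proof (intro conjI ballI allI impI)
  fix v w assume "v \<in> V" "w \<in> V"
  then show "(if v + w \<in> V then v + w else 0) = (if v \<in> V then v else 0) + (if w \<in> V then w else 0)"
    by (simp only: fvs.subspace_add[OF assms] if_True)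
next
  fix c v assume "v \<in> V"
  then show "(if fscale c v \<in> V then fscale c v else 0) = fscale c (if v \<in> V then v else 0)"
    by (simp only: fvs.subspace_scale[OF assms] if_True)
next
  fix v assume "v \<notin> V"
  then show "(if v \<in> V then v else 0) = 0"
    by (rule if_not_P)
qed

lemma linear_on_comp:
  assumes "linear_on V f" "\<forall>v\<in>V. f v \<in> W" "fvs.subspace W" "linear_on W g"
  shows "linear_on V (\<lambda>v. g (f v))"
  unfolding linear_on_def
proof (intro conjI ballI allI impI)
  fix v w assume "v \<in> V" "w \<in> V"
  then show "g (f (v + w)) = g (f v) + g (f w)"
    by (simp only: linear_on_add[OF assms(1)] linear_on_add[OF assms(4)] bspec[OF assms(2)])
next
  fix c v assume "v \<in> V"
  then show "g (f (fscale c v)) = fscale c (g (f v))"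
    by (simp only: linear_on_scale[OF assms(1)] linear_on_scale[OF assms(4)] bspec[OF assms(2)])
next
  fix v assume "v \<notin> V"
  then show "g (f v) = 0"
    by (simp add: linear_on_outside[OF assms(1)] linear_on_0[OF assms(3,4)])
qed

lemma uC_coalgebraD:
  assumes "uC_coalgebra C"
  shows "fvs.subspace (spc C n)"
    and "v \<in> spc C n \<Longrightarrow> dif C n v \<in> spc C (n - 1)"
    and "c \<in> spc C n \<Longrightarrow> comul C n c p q \<in> tensor_space (spc C p) (spc C q)"
proof -
  have 1: "chain_complex C"
    using assms unfolding uC_coalgebra_def by (rule conjunct1)
  have 2: "\<forall>n. \<forall>c\<in>spc C n. comul C n c \<in> tensor_deg C C n \<and>
      comul C (n - 1) (dif C n c) = tensor_dif C C (comul C n c)"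
    using assms unfolding uC_coalgebra_def by (elim conjE)
  show "fvs.subspace (spc C n)" and "v \<in> spc C n \<Longrightarrow> dif C n v \<in> spc C (n - 1)"
    using 1 unfolding chain_complex_def by blast+
  show "comul C n c p q \<in> tensor_space (spc C p) (spc C q)" if "c \<in> spc C n"
    using bspec[OF spec[OF 2] that] unfolding tensor_deg_def by blast
qed

lemma coalgebra_map_ide:
  assumes "uC_coalgebra C"
  shows "coalgebra_map C C (\<lambda>n v. if v \<in> spc C n then v else 0)"
proof -
  have S: "fvs.subspace (spc C n)" for n
    using uC_coalgebraD(1)[OF assms] .
  have "map_left (\<lambda>v. if v \<in> spc C p then v else 0) (map_right (\<lambda>v. if v \<in> spc C q then v else 0) t) = t"
    if "t \<in> tensor_space (spc C p) (spc C q)" for p q t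
  proof -
    have 1: "map_right (\<lambda>v. if v \<in> spc C q then v else 0) t = t"
      using row_in[OF that S] by (simp add: map_right_def)
    show ?thesis
      unfolding 1 using column_in[OF that S] by (simp add: map_left_def)
  qed
  note E = this
  have "tensor_map (\<lambda>n v. if v \<in> spc C n then v else 0) (\<lambda>n v. if v \<in> spc C n then v else 0)
      (comul C n c) = comul C n c" if "c \<in> spc C n" for n c
    by (simp only: tensor_map_def E[OF uC_coalgebraD(3)[OF assms that]])
  moreover have "dif C n v \<in> spc C (n - 1)" if "v \<in> spc C n" for n v
    using uC_coalgebraD(2)[OF assms that] .
  ultimately show ?thesis
    using linear_on_ide[OF S] by (simp add: coalgebra_map_def chain_map_def)
qed

lemma coalgebra_map_comp:
  assumes "uC_coalgebra C" "uC_coalgebra D" "uC_coalgebra E"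
    and "coalgebra_map C D f" "coalgebra_map D E g"
  shows "coalgebra_map C E (\<lambda>n v. g n (f n v))"
proof -
  have S: "fvs.subspace (spc C n)" "fvs.subspace (spc D n)" for n
    using uC_coalgebraD(1) assms by blast+
  have L: "linear_on (spc C n) (f n)" "linear_on (spc D n) (g n)" for n
    using assms(4,5) by (simp_all add: coalgebra_map_def chain_map_def)
  have I: "\<forall>v\<in>spc C n. f n v \<in> spc D n" "\<forall>w\<in>spc D n. g n w \<in> spc E n" for n
    using assms(4,5) by (simp_all add: coalgebra_map_def chain_map_def)
  have T: "tensor_map g g (tensor_map f f t) = tensor_map (\<lambda>n v. g n (f n v)) (\<lambda>n v. g n (f n v)) t"
    if "\<And>p q. t p q \<in> tensor_space (spc C p) (spc C q)" for t
  proof -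
    have "map_left (g p) (map_right (g q) (map_left (f p) (map_right (f q) (t p q)))) =
          map_left (\<lambda>v. g p (f p v)) (map_right (\<lambda>v. g q (f q v)) (t p q))" for p q
    proof -
      have "map_left (g p) (map_right (g q) (map_left (f p) (map_right (f q) (t p q)))) =
            map_left (g p) (map_left (f p) (map_right (g q) (map_right (f q) (t p q))))"
        unfolding map_left_right[OF S(1) L(1) I(1) S(2) L(2) I(2)
            map_right_in[OF S(1) L(1) I(1) that[of p q] S(1)]] by (rule refl)
      also have "\<dots> = map_left (\<lambda>v. g p (f p v)) (map_right (\<lambda>v. g q (f q v)) (t p q))"
        by (simp add: map_left_def map_right_def)
      finally show ?thesis .
    qed
    then show ?thesis
      unfolding tensor_map_def by blast
  qed
  have "comul E n (g n (f n c)) = tensor_map (\<lambda>n v. g n (f n v)) (\<lambda>n v. g n (f n v)) (comul C n c)"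
    if "c \<in> spc C n" for n c
  proof -
    have "comul E n (g n (f n c)) = tensor_map g g (tensor_map f f (comul C n c))"
      using assms(4,5) that I by (simp add: coalgebra_map_def)
    also have "\<dots> = tensor_map (\<lambda>n v. g n (f n v)) (\<lambda>n v. g n (f n v)) (comul C n c)"
      using uC_coalgebraD(3)[OF assms(1) that] by (intro T)
    finally show ?thesis .
  qed
  moreover have "chain_map C E (\<lambda>n v. g n (f n v))"
    using assms(4,5) I linear_on_comp[OF L(1) I(1) S(2) L(2)]
    unfolding coalgebra_map_def chain_map_def by metis
  moreover have "counit E (g 0 (f 0 c)) = counit C c" if "c \<in> spc C 0" for c
    using assms(4,5) I that by (simp add: coalgebra_map_def)
  ultimately show ?thesis
    by (simp add: coalgebra_map_def)
qed

lemma category_uC_Coalg: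
  "category (uC_Coalg :: (('u, 'k::field) coalgebra_data,
    (('u, 'k) coalgebra_data, int \<Rightarrow> ('u \<Rightarrow> 'k) \<Rightarrow> ('u \<Rightarrow> 'k)) arrow) cat)"
proof -
  have Z: "v \<notin> spc (src f) n \<Longrightarrow> fn f n v = 0" "v \<in> spc (src f) n \<Longrightarrow> fn f n v \<in> spc (trg f) n"
    "fn f n 0 = 0"
    if "uC_coalgebra (src f)" "coalgebra_map (src f) (trg f) (fn f)"
    for f :: "(('u, 'k) coalgebra_data, int \<Rightarrow> ('u \<Rightarrow> 'k) \<Rightarrow> ('u \<Rightarrow> 'k)) arrow" and n v
    using that(2) linear_on_0[OF uC_coalgebraD(1)[OF that(1)], of n "fn f n"]
    unfolding coalgebra_map_def chain_map_def linear_on_def by blast+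
  have U: "comp uC_Coalg f (ide uC_Coalg (src f)) = f \<and> comp uC_Coalg (ide uC_Coalg (trg f)) f = f"
    if "uC_coalgebra (src f)" "coalgebra_map (src f) (trg f) (fn f)"
    for f :: "(('u, 'k) coalgebra_data, int \<Rightarrow> ('u \<Rightarrow> 'k) \<Rightarrow> ('u \<Rightarrow> 'k)) arrow"
  proof -
    have "fn f n (if v \<in> spc (src f) n then v else 0) = fn f n v" for n v
      using Z(1,3)[OF that] by (cases "v \<in> spc (src f) n") simp_all
    moreover have "(if fn f n v \<in> spc (trg f) n then fn f n v else 0) = fn f n v" for n v
      using Z(1,2)[OF that] by (cases "v \<in> spc (src f) n") simp_all
    ultimately show ?thesis
      by (simp add: uC_Coalg_def)
  qed
  show ?thesis
    unfolding category_def
  proof (intro conjI ballI impI)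
    fix f :: "(('u, 'k) coalgebra_data, int \<Rightarrow> ('u \<Rightarrow> 'k) \<Rightarrow> ('u \<Rightarrow> 'k)) arrow"
    assume "f \<in> arr uC_Coalg"
    then have f: "uC_coalgebra (src f)" "uC_coalgebra (trg f)" "coalgebra_map (src f) (trg f) (fn f)"
      by (simp_all add: uC_Coalg_def)
    show "dom uC_Coalg f \<in> obj uC_Coalg" "cod uC_Coalg f \<in> obj uC_Coalg"
      using f by (simp_all add: uC_Coalg_def)
    show "comp uC_Coalg f (ide uC_Coalg (dom uC_Coalg f)) = f"
      "comp uC_Coalg (ide uC_Coalg (cod uC_Coalg f)) f = f"
      using U[OF f(1,3)] by (simp_all add: uC_Coalg_def)
    fix g assume "g \<in> arr uC_Coalg" and eq: "cod uC_Coalg f = dom uC_Coalg g"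
    then have g: "uC_coalgebra (src g)" "uC_coalgebra (trg g)" "coalgebra_map (src g) (trg g) (fn g)"
      and st: "trg f = src g"
      by (simp_all add: uC_Coalg_def)
    show "comp uC_Coalg g f \<in> hom uC_Coalg (dom uC_Coalg f) (cod uC_Coalg g)"
      using f(1) g(2) coalgebra_map_comp[OF f(1,2) g(2) f(3) g(3)[folded st]]
      by (simp add: uC_Coalg_def hom_def)
  next
    fix X :: "('u, 'k) coalgebra_data"
    assume "X \<in> obj uC_Coalg"
    then show "ide uC_Coalg X \<in> hom uC_Coalg X X"
      using coalgebra_map_ide[of X] by (simp add: uC_Coalg_def hom_def)
  qed (simp add: uC_Coalg_def)
qed


section \<open>Coadmissibility\<close>

text \<open>In the following, \<open>\<A>\<close> is a category of chain complexes with additional structure, such as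
  the category of coalgebras over a dg-operad.\<close>

definition weak_equivalences ::
  "(('u, 'k::field, 'x) complex_data_scheme, ('u, 'k, 'x) complex_arrow) cat \<Rightarrow>
   ('u, 'k, 'x) complex_arrow set" where
  "weak_equivalences \<A> = {f \<in> arr \<A>. quasi_iso (src f) (trg f) (fn f)}"

definition cofibrations ::
  "(('u, 'k::field, 'x) complex_data_scheme, ('u, 'k, 'x) complex_arrow) cat \<Rightarrow>
   ('u, 'k, 'x) complex_arrow set" where
  "cofibrations \<A> = {f \<in> arr \<A>. \<forall>n. inj_on (fn f n) (spc (src f) n)}"

definition fibrations ::
  "(('u, 'k::field, 'x) complex_data_scheme, ('u, 'k, 'x) complex_arrow) cat \<Rightarrow>
   ('u, 'k, 'x) complex_arrow set" where
  "fibrations \<A> = rlp \<A> (weak_equivalences \<A> \<inter> cofibrations \<A>)"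

text \<open>A dg-operad is coadmissible if its category of coalgebras satisfies the following.\<close>

definition coadmissible ::
  "(('u, 'k::field, 'x) complex_data_scheme, ('u, 'k, 'x) complex_arrow) cat \<Rightarrow> bool" where
  "coadmissible \<A> \<longleftrightarrow>
     model_category \<A> (weak_equivalences \<A>) (cofibrations \<A>) (fibrations \<A>)"

end

theory Submission
  imports Defs
begin

text \<open>
  Two homologous grouplike elements \<open>a\<close> and \<open>b\<close> of degree 0 in a \<open>uC\<close>-coalgebra \<open>C\<close> are equal.
  Indeed, let \<open>a - b = dh\<close> with \<open>a \<noteq> b\<close>, choose a functional \<open>\<phi>\<close> on \<open>C\<^sub>0\<close> with \<open>\<phi> a = 1\<close> and
  \<open>\<phi> b = 0\<close>, and let \<open>T = (\<phi> \<otimes> id) \<circ> \<Delta>\<close>. Since \<open>\<phi> \<mapsto> \<phi> \<circ> d\<close> is a derivation of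
  the convolution algebra, the power rule for the convolution powers of \<open>\<phi>\<close> reads
  \<open>(k + 1) \<phi> (d (T\<^sup>k h)) = \<phi> (T\<^sup>k (dh)) = 1\<close>. But the vectors \<open>T\<^sup>k h\<close> with \<open>k > 0\<close> span a
  finite-dimensional space (spanned by the right tensor factors of \<open>\<Delta> h\<close>), so the sequence
  \<open>1/(k + 1)\<close> would satisfy a linear recurrence, which is impossible in characteristic zero.

  Hence the map from the coalgebra on two grouplike elements that identifies both of them cannot be
  factored into a monomorphism followed by a quasi-isomorphism.
\<close>

section \<open>Linear recurrences\<close>

text \<open>Clearing denominators, as with partial fractions, turns the relation for
  \<open>k\<close> into the vanishing at \<open>k\<close> of one polynomial independent of
  \<open>k\<close>. In characteristic zero these are infinitely many roots, so the polynomial is 0,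
  and its value at the pole \<open>- j - 1\<close> isolates \<open>c j\<close>.\<close>

lemma reciprocals_no_linear_recurrence:
  fixes c :: "nat \<Rightarrow> 'k::field_char_0"
  assumes "finite A" "\<And>k. (\<Sum>i\<in>A. c i / of_nat (i + k + 1)) = 0" "j \<in> A"
  shows "c j = 0"
proof -
  define P where "P = (\<Sum>i\<in>A. smult (c i) (\<Prod>l\<in>A - {i}. [:of_nat l + 1, 1:]))"
  have "poly P (of_nat k) = 0" for k
  proof -
    have nz: "of_nat l + 1 + of_nat k \<noteq> (0::'k)" for l
      by (metis of_nat_Suc of_nat_add add_Suc of_nat_eq_0_iff nat.distinct(1) add.commute add.assoc)
    have "poly P (of_nat k) = (\<Sum>i\<in>A. c i * (\<Prod>l\<in>A - {i}. of_nat l + 1 + of_nat k))"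
      by (simp add: P_def poly_sum poly_prod)
    also have "\<dots> = (\<Sum>i\<in>A. (\<Prod>l\<in>A. of_nat l + 1 + of_nat k) * (c i / of_nat (i + k + 1)))"
      using assms(1) nz by (intro sum.cong) (simp_all add: prod.remove add_ac)
    also have "\<dots> = 0"
      using assms(2)[of k] by (simp only: flip: sum_distrib_left) simp
    finally show ?thesis .
  qed
  then have "range of_nat \<subseteq> {x. poly P x = 0}"
    by auto
  moreover have "infinite (range (of_nat :: nat \<Rightarrow> 'k))"
    by (simp add: inj_of_nat finite_image_iff)
  ultimately have "P = 0"
    using poly_roots_finite finite_subset by blast
  \<comment> \<open>At the pole \<open>- j - 1\<close> the factor with \<open>l = j\<close> is 0,
    and it occurs in every summand except the one with \<open>i = j\<close>.\<close>
  have "c i * (\<Prod>l\<in>A - {i}. of_nat l - of_nat j) = 0" if "i \<in> A - {j}" for i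
    using that assms(1,3) by auto
  then have "(\<Sum>i\<in>A. c i * (\<Prod>l\<in>A - {i}. of_nat l - of_nat j)) = c j * (\<Prod>l\<in>A - {j}. of_nat l - of_nat j)"
    by (simp add: sum.remove[OF assms(1,3)] sum.neutral)
  moreover have "poly P (- of_nat j - 1) = (\<Sum>i\<in>A. c i * (\<Prod>l\<in>A - {i}. of_nat l - of_nat j))"
    by (simp add: P_def poly_sum poly_prod)
  ultimately have "c j * (\<Prod>l\<in>A - {j}. of_nat l - of_nat j) = 0"
    using \<open>P = 0\<close> by simp
  then show ?thesis
    using assms(1) by auto
qed

text \<open>More than \<open>card F\<close> distinct vectors in the span of \<open>F\<close> are
  dependent. Coefficients are indexed by positions in the sequence, since they will be matched with
  exponents; repetitions therefore need a separate case.\<close>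

lemma linear_relation_in_finite_span:
  fixes v :: "nat \<Rightarrow> 'a \<Rightarrow> 'k::field"
  assumes "finite F" "\<And>i. v i \<in> fvs.span F"
  obtains A c j where "finite A" "j \<in> A" "c j \<noteq> 0" "(\<Sum>i\<in>A. fscale (c i) (v i)) = 0"
proof (cases "inj v")
  case True
  have "\<not> fvs.independent (v ` {..card F})"
  proof
    assume "fvs.independent (v ` {..card F})"
    then have "card (v ` {..card F}) \<le> card F"
      using fvs.independent_span_bound[OF assms(1)] assms(2) by blast
    moreover have "card (v ` {..card F}) = Suc (card F)"
      using card_image[OF inj_on_subset[OF True]] by force
    ultimately show False by simp
  qed
  then obtain u where "\<exists>x\<in>v ` {..card F}. u x \<noteq> 0" "(\<Sum>x\<in>v ` {..card F}. fscale (u x) x) = 0"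
    using fvs.dependent_finite[of "v ` {..card F}"] by auto
  then obtain j where "j \<le> card F" "u (v j) \<noteq> 0" "(\<Sum>i\<le>card F. fscale (u (v i)) (v i)) = 0"
    by (auto simp: sum.reindex[OF inj_on_subset[OF True subset_UNIV]])
  then show ?thesis
    using that[of "{..card F}" j "\<lambda>i. u (v i)"] by blast
next
  case False
  then obtain i j where ij: "v i = v j" "i \<noteq> j"
    unfolding inj_def by blast
  \<comment> \<open>A repeated vector gives the relation \<open>v i - v j = 0\<close>.\<close>
  show ?thesis
  proof (rule that)
    show "(\<Sum>l\<in>{i, j}. fscale (if l = i then 1 else - 1) (v l)) = 0"
      using ij by (simp add: fscale_def fun_eq_iff)
  qed (use ij in auto)
qed


section \<open>Contractions\<close>

lemma functional_on_0: "functional_on V e \<Longrightarrow> fvs.subspace V \<Longrightarrow> e 0 = 0"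
  using fvs.subspace_0[of V] unfolding functional_on_def by (metis fvs.scale_zero_left mult_zero_left)

lemma functional_on_sum:
  assumes "functional_on V e" "fvs.subspace V" "finite A" "\<And>i. v i \<in> V"
  shows "e (\<Sum>i\<in>A. fscale (c i) (v i)) = (\<Sum>i\<in>A. c i * e (v i))"
  using assms(3)
proof (induction rule: finite_induct)
  case empty
  show ?case
    by (simp only: sum.empty functional_on_0[OF assms(1,2)])
next
  case (insert i A)
  have 1: "fscale (c i) (v i) \<in> V" for i
    using fvs.subspace_scale[OF assms(2,4)] .
  with fvs.subspace_sum[OF assms(2), of A "\<lambda>i. fscale (c i) (v i)"]
  have "e (fscale (c i) (v i) + (\<Sum>i\<in>A. fscale (c i) (v i))) =
      c i * e (v i) + e (\<Sum>i\<in>A. fscale (c i) (v i))"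
    using assms(1,4) unfolding functional_on_def by metis
  then show ?case
    unfolding sum.insert[OF insert.hyps] insert.IH .
qed

lemma contract_left_0: "functional_on V e \<Longrightarrow> fvs.subspace V \<Longrightarrow> contract_left e 0 = 0"
  using functional_on_0[of V e] by (simp add: contract_left_def zero_fun_def)

lemma contract_left_scale_tensor:
  assumes "functional_on V e" "v \<in> V" "fvs.subspace V"
  shows "contract_left e (fscale c (tensor v w)) = fscale (c * e v) w"
  using assms fvs.subspace_scale[OF assms(3,2), of c]
  by (simp add: fscale_tensor contract_left_tensor) (simp add: functional_on_def)

lemma contract_left_add:
  assumes "functional_on V e" "fvs.subspace V" "s \<in> tensor_space V W" "t \<in> tensor_space V W"
  shows "contract_left e (s + t) = contract_left e s + contract_left e t"
proof -
  have "(\<lambda>x. (s + t) (x, y)) = (\<lambda>x. s (x, y)) + (\<lambda>x. t (x, y))" for y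
    by auto
  then show ?thesis
    using column_in[OF assms(3,2)] column_in[OF assms(4,2)] assms(1)
    by (simp add: contract_left_def functional_on_def fun_eq_iff del: plus_fun_apply)
       (simp add: plus_fun_def)
qed

lemma contract_left_fscale:
  assumes "functional_on V e" "fvs.subspace V" "t \<in> tensor_space V W"
  shows "contract_left e (fscale c t) = fscale c (contract_left e t)"
proof -
  have "(\<lambda>x. fscale c t (x, y)) = fscale c (\<lambda>x. t (x, y))" for y
    by (simp add: fscale_def)
  then show ?thesis
    using column_in[OF assms(3,2)] assms(1)
    by (simp add: contract_left_def functional_on_def) (simp add: fscale_def)
qed

text \<open>A tensor is a finite sum of elementary ones, and contraction only recombines their right
  factors. The point is that \<open>F\<close> is chosen before \<open>e\<close>, so one finite set
  serves all functionals.\<close>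

lemma contract_left_in_finite_span:
  assumes "fvs.subspace V" "t \<in> tensor_space V W"
  obtains F where "finite F" "F \<subseteq> W" "\<And>e. functional_on V e \<Longrightarrow> contract_left e t \<in> fvs.span F"
proof -
  have "\<exists>F. finite F \<and> F \<subseteq> W \<and> (\<forall>e. functional_on V e \<longrightarrow> contract_left e t \<in> fvs.span F)"
    using assms(2)
  proof (induction rule: tensor_space_induct)
    case zero
    then show ?case
      using contract_left_0[OF _ assms(1)] fvs.span_zero by (metis finite.emptyI empty_subsetI)
  next
    case (tensor c v w)
    have "contract_left e (fscale c (tensor v w)) \<in> fvs.span {w}" if "functional_on V e" for e
      by (simp add: contract_left_scale_tensor[OF that tensor(1) assms(1)] fvs.span_scale fvs.span_base)
    then show ?case
      using tensor by (intro exI[of _ "{w}"]) simp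
  next
    case (add s t)
    then obtain F G where F: "finite F" "F \<subseteq> W" "\<And>e. functional_on V e \<Longrightarrow> contract_left e s \<in> fvs.span F"
      and G: "finite G" "G \<subseteq> W" "\<And>e. functional_on V e \<Longrightarrow> contract_left e t \<in> fvs.span G"
      by blast
    have "contract_left e (s + t) \<in> fvs.span (F \<union> G)" if "functional_on V e" for e
      unfolding contract_left_add[OF that assms(1) add(1,2)]
      using F(3)[OF that] G(3)[OF that] fvs.span_mono[of F "F \<union> G"] fvs.span_mono[of G "F \<union> G"]
      by (intro fvs.span_add) auto
    then have "\<forall>e. functional_on V e \<longrightarrow> contract_left e (s + t) \<in> fvs.span (F \<union> G)"
      by (rule allI[OF impI])
    with F(1,2) G(1,2) show ?case
      by (intro exI[of _ "F \<union> G"] conjI finite_UnI Un_least)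
  qed
  then show ?thesis
    using that by blast
qed

lemma contract_left_in:
  assumes "fvs.subspace V" "fvs.subspace W" "t \<in> tensor_space V W" "functional_on V e"
  shows "contract_left e t \<in> W"
proof -
  obtain F where "F \<subseteq> W" "contract_left e t \<in> fvs.span F"
    using contract_left_in_finite_span[OF assms(1,3)] assms(4) by metis
  then show ?thesis
    using fvs.span_minimal[OF _ assms(2)] by (meson subsetD)
qed

lemma contract_left_map_right:
  assumes V: "fvs.subspace V" "functional_on V e" and W: "fvs.subspace W" "linear_on W g"
    and "t \<in> tensor_space V W"
  shows "contract_left e (map_right g t) = g (contract_left e t)"
  using assms(5)
proof (induction rule: tensor_space_induct)
  case zero
  then show ?case
    by (metis contract_left_0[OF V(2,1)] map_right_0[OF W] linear_on_0[OF W])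
next
  case (tensor c v w)
  then have cv: "fscale c v \<in> V" using fvs.subspace_scale[OF V(1)] by blast
  show ?case
    using tensor
    by (simp add: fscale_tensor map_right_tensor[OF W(2)] contract_left_tensor[OF V(2) cv]
        linear_on_scale[OF W(2)])
next
  case (add s t)
  \<comment> \<open>The target is \<open>UNIV\<close> because nothing is assumed about the values of
    \<open>g\<close>.\<close>
  have "map_right g s \<in> tensor_space V UNIV" "map_right g t \<in> tensor_space V UNIV"
    using add(1,2) map_right_in[OF W _ _ V(1)] by blast+
  from contract_left_add[OF V(2,1) this] show ?case
    unfolding map_right_add[OF W add(1,2)] contract_left_add[OF V(2,1) add(1,2)]
      linear_on_add[OF W(2) contract_left_in[OF V(1) W(1) add(1) V(2)] contract_left_in[OF V(1) W(1) add(2) V(2)]]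
    by (simp only: add(3,4))
qed

text \<open>Both sides evaluate the tensor product of \<open>e\<close> and \<open>f\<close> on
  \<open>t\<close>, contracting the two factors in either order.\<close>

lemma contract_left_swap:
  assumes V: "fvs.subspace V" "functional_on V e" and W: "fvs.subspace W" "functional_on W f"
    and "t \<in> tensor_space V W"
  shows "e (contract_left f (swap t)) = f (contract_left e t)"
proof -
  \<comment> \<open>Functions on \<open>unit\<close> form a one-dimensional space, so
    \<open>f\<close> becomes a linear map to which \<open>contract_left_map_right\<close>
    applies.\<close>
  define g where "g = (\<lambda>w (_ :: unit). f w)"
  have g: "linear_on W g"
    using W(2) by (auto simp: linear_on_def functional_on_def g_def fscale_def fun_eq_iff)
  have "e (contract_left f (swap t)) = contract_left e (map_right g t) ()"
    by (simp add: contract_left_def swap_def map_right_def g_def)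
  also have "\<dots> = f (contract_left e t)"
    unfolding contract_left_map_right[OF V W(1) g assms(5)] by (simp add: g_def)
  finally show ?thesis .
qed


section \<open>The action of the dual of a coalgebra\<close>

text \<open>The operator T of the overview, in degree \<open>n\<close>. A functional on degree 0
  sees only the component of bidegree \<open>(0, n)\<close>.\<close>

definition act :: "('u, 'k::field) coalgebra_data \<Rightarrow> (('u \<Rightarrow> 'k) \<Rightarrow> 'k) \<Rightarrow> int \<Rightarrow> ('u \<Rightarrow> 'k) \<Rightarrow> ('u \<Rightarrow> 'k)" where
  "act C e n c = contract_left e (comul C n c 0 n)"

context
  fixes C :: "('u, 'k::field) coalgebra_data"
  assumes C: "uC_coalgebra C"
begin

lemma
  shows dif_linear: "linear_on (spc C n) (dif C n)"
    and comul_linear: "linear_on (spc C n) (\<lambda>c. comul C n c p q)"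
    and counit_functional: "functional_on (spc C 0) (counit C)"
    and comul_dif: "c \<in> spc C n \<Longrightarrow> comul C (n - 1) (dif C n c) = tensor_dif C C (comul C n c)"
    and coassoc: "c \<in> spc C n \<Longrightarrow>
        reassoc (map_left (\<lambda>v. comul C (p + q) v p q) (comul C n c (p + q) r)) =
        map_right (\<lambda>v. comul C (q + r) v q r) (comul C n c p (q + r))"
    and cocomm: "c \<in> spc C n \<Longrightarrow> comul C n c q p = fscale (koszul (p * q)) (swap (comul C n c p q))"
proof -
  note D = C[unfolded uC_coalgebra_def, THEN conjunct2]
  have "\<forall>n. fvs.subspace (spc C n) \<and> spc C n \<prec> (UNIV :: 'u set) \<and> linear_on (spc C n) (dif C n) \<and>
      (\<forall>v\<in>spc C n. dif C n v \<in> spc C (n - 1) \<and> dif C (n - 1) (dif C n v) = 0)"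
    using C[unfolded uC_coalgebra_def, THEN conjunct1] unfolding chain_complex_def .
  from this[rule_format, of n] show "linear_on (spc C n) (dif C n)"
    by (elim conjE)
  show "linear_on (spc C n) (\<lambda>c. comul C n c p q)"
    by (rule D[THEN conjunct1, rule_format])
  note D = D[THEN conjunct2]
  show "comul C (n - 1) (dif C n c) = tensor_dif C C (comul C n c)" if "c \<in> spc C n"
    by (rule D[THEN conjunct1, rule_format, OF that, THEN conjunct2])
  note D = D[THEN conjunct2]
  show "functional_on (spc C 0) (counit C)"
    by (rule D[THEN conjunct1])
  note D = D[THEN conjunct2, THEN conjunct2]
  show "reassoc (map_left (\<lambda>v. comul C (p + q) v p q) (comul C n c (p + q) r)) =
      map_right (\<lambda>v. comul C (q + r) v q r) (comul C n c p (q + r))" if "c \<in> spc C n"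
    by (rule D[THEN conjunct1, rule_format, OF that])
  note D = D[THEN conjunct2, THEN conjunct2]
  show "comul C n c q p = fscale (koszul (p * q)) (swap (comul C n c p q))" if "c \<in> spc C n"
    by (rule D[rule_format, OF that])
qed

lemmas spc_subspace = uC_coalgebraD(1)[OF C]
lemmas dif_in = uC_coalgebraD(2)[OF C]
lemmas comul_in = uC_coalgebraD(3)[OF C]

lemma act_in: "functional_on (spc C 0) e \<Longrightarrow> c \<in> spc C n \<Longrightarrow> act C e n c \<in> spc C n"
  unfolding act_def using contract_left_in[OF spc_subspace spc_subspace comul_in] .

lemma act_linear:
  assumes "functional_on (spc C 0) e"
  shows "linear_on (spc C n) (act C e n)"
  unfolding linear_on_def act_def
proof (intro conjI ballI allI impI)
  fix v w assume vw: "v \<in> spc C n" "w \<in> spc C n"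
  show "contract_left e (comul C n (v + w) 0 n) =
      contract_left e (comul C n v 0 n) + contract_left e (comul C n w 0 n)"
    unfolding linear_on_add[OF comul_linear vw]
    using contract_left_add[OF assms spc_subspace comul_in[OF vw(1)] comul_in[OF vw(2)]] .
next
  fix c v assume v: "v \<in> spc C n"
  show "contract_left e (comul C n (fscale c v) 0 n) = fscale c (contract_left e (comul C n v 0 n))"
    unfolding linear_on_scale[OF comul_linear v]
    using contract_left_fscale[OF assms spc_subspace comul_in[OF v]] .
next
  fix v assume "v \<notin> spc C n"
  from linear_on_outside[OF comul_linear this] show "contract_left e (comul C n v 0 n) = 0"
    using contract_left_0[OF assms spc_subspace] by simp
qed

lemma functional_on_linear_on_comp:
  assumes "functional_on (spc C n) e" "linear_on (spc C m) g" "\<And>v. v \<in> spc C m \<Longrightarrow> g v \<in> spc C n"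
  shows "functional_on (spc C m) (\<lambda>c. e (g c))"
  using assms(1,3) functional_on_0[OF assms(1) spc_subspace] linear_on_add[OF assms(2)]
    linear_on_scale[OF assms(2)] linear_on_outside[OF assms(2)]
  unfolding functional_on_def by simp

text \<open>The functional on the left is the convolution product of \<open>e\<close> and
  \<open>e'\<close>. It contracts the first two factors of the twofold comultiplication, and
  coassociativity lets this be done one factor at a time.\<close>

lemma act_convolution:
  assumes "functional_on (spc C 0) e" "c \<in> spc C n"
  shows "act C (\<lambda>x. e' (act C e 0 x)) n c = act C e' n (act C e n c)"
proof -
  have "act C (\<lambda>x. e' (act C e 0 x)) n c =
      contract_left e' (contract_left e (reassoc (map_left (\<lambda>v. comul C 0 v 0 0) (comul C n c 0 n))))"
    by (simp add: act_def contract_left_def reassoc_def map_left_def)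
  also have "\<dots> = contract_left e' (contract_left e (map_right (\<lambda>v. comul C n v 0 n) (comul C n c 0 n)))"
    using coassoc[OF assms(2), of 0 0 n] by simp
  also have "\<dots> = act C e' n (act C e n c)"
    unfolding contract_left_map_right[OF spc_subspace assms(1) spc_subspace comul_linear comul_in[OF assms(2)]]
    by (simp add: act_def)
  finally show ?thesis .
qed

text \<open>The comultiplication is a chain map, so \<open>dif\<close> can be moved onto either
  factor: this is the Leibniz rule for precomposing a convolution product with \<open>dif\<close>.
  Cocommutativity brings the term with \<open>dif\<close> on the left factor into the form of an
  action on \<open>h\<close>.\<close>

lemma act_derivation:
  assumes e: "functional_on (spc C 0) e" "functional_on (spc C 0) e'" and h: "h \<in> spc C 1"
  shows "e' (act C e 0 (dif C 1 h)) = e' (dif C 1 (act C e 1 h)) + e (dif C 1 (act C e' 1 h))"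
proof -
  have d: "linear_on (spc C 1) (dif C 1)" "\<And>v. v \<in> spc C 1 \<Longrightarrow> dif C 1 v \<in> spc C 0"
    using dif_linear dif_in[of _ 1] by auto
  have ed: "functional_on (spc C 1) (\<lambda>v. e (dif C 1 v))"
    using functional_on_linear_on_comp[OF e(1) d] .
  define s where "s = comul C 1 h 1 0"
  define t where "t = comul C 1 h 0 1"
  have st: "s \<in> tensor_space (spc C 1) (spc C 0)" "t \<in> tensor_space (spc C 0) (spc C 1)"
    using comul_in[OF h] by (simp_all add: s_def t_def)
  \<comment> \<open>The Koszul sign is trivial, the product of the degrees being 0.\<close>
  have "s = swap t"
    using cocomm[OF h, of 1 0] by (simp add: s_def t_def koszul_def fscale_def)
  \<comment> \<open>Bidegree \<open>(0, 0)\<close> of the tensor differential is reached from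
    \<open>(1, 0)\<close> and \<open>(0, 1)\<close>, both with sign +1.\<close>
  have 0: "comul C 0 (dif C 1 h) 0 0 = map_left (dif C 1) s + map_right (dif C 1) t"
    using comul_dif[OF h] by (simp add: tensor_dif_def s_def t_def koszul_def fscale_def)
  have "map_left (dif C 1) s \<in> tensor_space (spc C 0) (spc C 0)"
    "map_right (dif C 1) t \<in> tensor_space (spc C 0) (spc C 0)"
    using map_left_in[OF spc_subspace d(1) _ st(1)] map_right_in[OF spc_subspace d(1) _ st(2) spc_subspace] d(2)
    by blast+
  from contract_left_add[OF e(1) spc_subspace this]
  have "act C e 0 (dif C 1 h) = contract_left e (map_left (dif C 1) s) + contract_left e (map_right (dif C 1) t)"
    by (simp add: act_def 0)
  moreover have "contract_left e (map_left (dif C 1) s) = contract_left (\<lambda>v. e (dif C 1 v)) s"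
    by (simp add: contract_left_def map_left_def)
  moreover have "contract_left e (map_right (dif C 1) t) = dif C 1 (act C e 1 h)"
    using contract_left_map_right[OF spc_subspace e(1) spc_subspace d(1) st(2)] by (simp add: act_def t_def)
  moreover have "contract_left (\<lambda>v. e (dif C 1 v)) s \<in> spc C 0"
    using contract_left_in[OF spc_subspace spc_subspace st(1) ed] .
  moreover have "dif C 1 (act C e 1 h) \<in> spc C 0"
    using d(2) act_in[OF e(1) h] .
  moreover have "e' (contract_left (\<lambda>v. e (dif C 1 v)) s) = e (dif C 1 (act C e' 1 h))"
    using contract_left_swap[OF spc_subspace e(2) spc_subspace ed st(2)] \<open>s = swap t\<close>
    by (simp add: act_def t_def)
  ultimately show ?thesis
    using e(2) by (simp add: functional_on_def)
qed

lemma act_power_in: "functional_on (spc C 0) e \<Longrightarrow> c \<in> spc C n \<Longrightarrow> (act C e n ^^ k) c \<in> spc C n"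
  by (induction k) (simp_all add: act_in)

text \<open>The functional here is the convolution power of \<open>e\<close> with exponent
  \<open>k + 1\<close>.\<close>

lemma functional_on_act_power:
  "functional_on (spc C 0) e \<Longrightarrow> functional_on (spc C 0) (\<lambda>x. e ((act C e 0 ^^ k) x))"
proof (induction k)
  case (Suc k)
  show ?case
    using functional_on_linear_on_comp[OF Suc.IH[OF Suc.prems] act_linear[OF Suc.prems] act_in[OF Suc.prems]]
    by (simp add: funpow_swap1)
qed simp

text \<open>Iterating \<open>act_convolution\<close> expresses a power of the operator as the action
  of a single functional, which makes the uniform finite span of
  \<open>contract_left_in_finite_span\<close> applicable to all powers at once.\<close>

lemma act_act_power:
  assumes "functional_on (spc C 0) e" "c \<in> spc C n"
  shows "act C (\<lambda>x. e ((act C e 0 ^^ k) x)) n c = (act C e n ^^ Suc k) c"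
  using assms(2)
proof (induction k arbitrary: c)
  case (Suc k)
  have "act C (\<lambda>x. e ((act C e 0 ^^ Suc k) x)) n c =
      act C (\<lambda>x. e ((act C e 0 ^^ k) (act C e 0 x))) n c"
    by (simp add: funpow_swap1)
  also have "\<dots> = act C (\<lambda>x. e ((act C e 0 ^^ k) x)) n (act C e n c)"
    using act_convolution[OF assms(1) Suc.prems, of "\<lambda>x. e ((act C e 0 ^^ k) x)"] .
  also have "\<dots> = (act C e n ^^ Suc (Suc k)) c"
    using Suc.IH[OF act_in[OF assms(1) Suc.prems]] by (simp add: funpow_swap1)
  finally show ?case .
qed simp

text \<open>The analogue of differentiating a power with exponent \<open>k + 1\<close>. Each
  induction step applies \<open>act_derivation\<close> once: the first term is the induction
  hypothesis at \<open>act C e 1 h\<close>, the second adds one more copy by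
  \<open>act_act_power\<close>.\<close>

lemma act_power_rule:
  assumes "functional_on (spc C 0) e" "h \<in> spc C 1"
  shows "e ((act C e 0 ^^ k) (dif C 1 h)) = of_nat (Suc k) * e (dif C 1 ((act C e 1 ^^ k) h))"
  using assms(2)
proof (induction k arbitrary: h)
  case (Suc k)
  have "e ((act C e 0 ^^ Suc k) (dif C 1 h)) = e ((act C e 0 ^^ k) (act C e 0 (dif C 1 h)))"
    by (simp add: funpow_swap1)
  also have "\<dots> = e ((act C e 0 ^^ k) (dif C 1 (act C e 1 h))) +
      e (dif C 1 (act C (\<lambda>x. e ((act C e 0 ^^ k) x)) 1 h))"
    using act_derivation[OF assms(1) functional_on_act_power[OF assms(1)] Suc.prems] .
  also have "\<dots> = of_nat (Suc (Suc k)) * e (dif C 1 ((act C e 1 ^^ Suc k) h))"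
    using Suc.IH[OF act_in[OF assms(1) Suc.prems]] act_act_power[OF assms(1) Suc.prems, of k]
    by (simp add: funpow_swap1 algebra_simps)
  finally show ?case .
qed simp

end

section \<open>Rigidity of grouplike elements under homology\<close>

lemma homologous_grouplike_eq:
  fixes C :: "('u, 'k::field_char_0) coalgebra_data"
  assumes C: "uC_coalgebra C"
    and a: "a \<in> spc C 0" "comul C 0 a 0 0 = tensor a a" "counit C a = 1"
    and b: "b \<in> spc C 0" "comul C 0 b 0 0 = tensor b b" "counit C b = 1"
    and h: "h \<in> spc C 1" "a = b + dif C 1 h"
  shows "a = b"
proof (rule ccontr)
  assume "a \<noteq> b"
  then obtain x where x: "a x - b x \<noteq> 0"
    by auto
  \<comment> \<open>The coordinate \<open>x\<close> separates \<open>a\<close> from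
    \<open>b\<close>. Subtracting \<open>b x\<close> times the counit, which is 1 on both, makes the
    functional vanish at \<open>b\<close>; dividing gives it the value 1 at
    \<open>a\<close>.\<close>
  define e where "e v = (if v \<in> spc C 0 then (v x - b x * counit C v) / (a x - b x) else 0)" for v
  have e: "functional_on (spc C 0) e"
    using counit_functional[OF C] fvs.subspace_add[OF spc_subspace[OF C]]
      fvs.subspace_scale[OF spc_subspace[OF C]]
    unfolding functional_on_def
    by (auto simp: e_def add_divide_distrib diff_divide_distrib algebra_simps)
       (simp_all add: fscale_def)
  have ea: "e a = 1" and eb: "e b = 0"
    using x a b by (simp_all add: e_def)
  have d: "dif C 1 h \<in> spc C 0"
    using dif_in[OF C h(1)] by simp
  \<comment> \<open>On a grouplike element the operator is multiplication by the value of
    \<open>e\<close>. Hence it fixes \<open>a\<close>, kills \<open>b\<close> and sends their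
    difference to \<open>a\<close>.\<close>
  have Ta: "act C e 0 a = a" and Tb: "act C e 0 b = 0"
    using a b ea eb by (simp_all add: act_def contract_left_tensor[OF e])
  have "act C e 0 a = act C e 0 b + act C e 0 (dif C 1 h)"
    unfolding h(2) using linear_on_add[OF act_linear[OF C e] b(1) d] .
  then have Td: "act C e 0 (dif C 1 h) = a"
    using Ta Tb by simp
  have "(act C e 0 ^^ k) a = a" for k
    by (induction k) (simp_all add: Ta)
  then have "e ((act C e 0 ^^ Suc k) (dif C 1 h)) = 1" for k
    using ea Td by (simp add: funpow_swap1)
  \<comment> \<open>Exponents start at 1, since \<open>act_act_power\<close> writes exactly these
    iterates as the action of one functional.\<close>
  then have lam: "e (dif C 1 ((act C e 1 ^^ Suc k) h)) = 1 / of_nat (Suc (Suc k))" for k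
    using act_power_rule[OF C e h(1), of "Suc k"] by (simp add: field_simps del: of_nat_Suc funpow.simps)
  obtain F where F: "finite F" "\<And>f. functional_on (spc C 0) f \<Longrightarrow> act C f 1 h \<in> fvs.span F"
    using contract_left_in_finite_span[OF spc_subspace[OF C] comul_in[OF C h(1)]] unfolding act_def by metis
  have span: "(act C e 1 ^^ Suc k) h \<in> fvs.span F" for k
    using F(2)[OF functional_on_act_power[OF C e]] act_act_power[OF C e h(1)] by metis
  obtain A c j where A: "finite A" "j \<in> A" "c j \<noteq> 0"
    "(\<Sum>i\<in>A. fscale (c i) ((act C e 1 ^^ Suc i) h)) = 0"
    by (rule linear_relation_in_finite_span[OF F(1) span])
  \<comment> \<open>Applying \<open>e\<close> after \<open>dif\<close> after \<open>k\<close>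
    further iterates to the relation in \<open>A(4)\<close> replaces each vector by a reciprocal, so
    a single relation yields one for every shift \<open>k\<close>.\<close>
  have "(\<Sum>i\<in>A. c i / of_nat (Suc i + k + 1)) = 0" for k
  proof -
    let ?g = "\<lambda>v. e (dif C 1 ((act C e 1 ^^ k) v))"
    have g: "functional_on (spc C 1) ?g"
    proof (induction k)
      case 0
      show ?case
        using functional_on_linear_on_comp[OF C e dif_linear[OF C, of 1]] dif_in[OF C, of _ 1] by simp
    next
      case (Suc k)
      show ?case
        using functional_on_linear_on_comp[OF C Suc.IH act_linear[OF C e] act_in[OF C e]]
        by (simp add: funpow_swap1)
    qed
    have "?g (\<Sum>i\<in>A. fscale (c i) ((act C e 1 ^^ Suc i) h)) = (\<Sum>i\<in>A. c i * ?g ((act C e 1 ^^ Suc i) h))"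
      using functional_on_sum[OF g spc_subspace[OF C] A(1) act_power_in[OF C e h(1)]] .
    also have "\<dots> = (\<Sum>i\<in>A. c i / of_nat (Suc i + k + 1))"
    proof (intro sum.cong refl)
      fix i
      have "?g ((act C e 1 ^^ Suc i) h) = e (dif C 1 ((act C e 1 ^^ Suc (i + k)) h))"
        by (metis funpow_add comp_apply add.commute add_Suc)
      then show "c i * ?g ((act C e 1 ^^ Suc i) h) = c i / of_nat (Suc i + k + 1)"
        using lam[of "i + k"] by simp
    qed
    finally show ?thesis
      unfolding A(4) functional_on_0[OF g spc_subspace[OF C]] by (rule sym)
  qed
  \<comment> \<open>The index moves up by one to give the denominators the form required by
    \<open>reciprocals_no_linear_recurrence\<close>.\<close>
  then have "(\<Sum>i\<in>Suc ` A. c (i - 1) / of_nat (i + k + 1)) = 0" for k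
    by (simp add: sum.reindex)
  from reciprocals_no_linear_recurrence[OF _ this, of "Suc j"] show False
    using A(1-3) by simp
qed


section \<open>Homology\<close>

text \<open>Injectivity on homology in terms of representatives. As \<open>homology_map\<close> is a
  union over a whole class, it is first shown that all members of the class contribute the same
  set.\<close>

lemma quasi_iso_inj:
  assumes C: "chain_complex C" and D: "chain_complex D"
    and f: "chain_map C D f" "quasi_iso C D f"
    and z: "z \<in> cycles C n" "w \<in> cycles C n" "f n z = f n w"
  obtains h where "h \<in> spc C (n + 1)" "z = w + dif C (n + 1) h"
proof -
  have subspace: "fvs.subspace (spc C m)" "fvs.subspace (spc D m)"
    and lin: "linear_on (spc C m) (dif C m)" "linear_on (spc D m) (dif D m)" for m
    using C D unfolding chain_complex_def by blast+
  have shift: "homology_class D n (y + dif D (n + 1) k) = homology_class D n y"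
    if k: "k \<in> spc D (n + 1)" for y k
  proof -
    have "homology_class D n (u + dif D (n + 1) l) \<subseteq> homology_class D n u"
      if l: "l \<in> spc D (n + 1)" for u l
    proof
      fix x assume "x \<in> homology_class D n (u + dif D (n + 1) l)"
      then obtain m where m: "m \<in> spc D (n + 1)" "x = u + dif D (n + 1) l + dif D (n + 1) m"
        unfolding homology_class_def boundaries_def by blast
      then have "x = u + dif D (n + 1) (l + m)"
        using linear_on_add[OF lin(2) l m(1)] by (simp only: add.assoc)
      then show "x \<in> homology_class D n u"
        using fvs.subspace_add[OF subspace(2) l m(1)] unfolding homology_class_def boundaries_def by blast
    qed
    note 1 = this
    \<comment> \<open>Translating back by the opposite boundary gives the reverse inclusion.\<close>
    have k': "fscale (- 1) k \<in> spc D (n + 1)"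
      using fvs.subspace_scale[OF subspace(2) k] .
    have 2: "y + dif D (n + 1) k + dif D (n + 1) (fscale (- 1) k) = y"
      unfolding linear_on_scale[OF lin(2) k] by (simp add: fscale_def fun_eq_iff)
    show ?thesis
      using 1[OF k, of y] 1[OF k', of "y + dif D (n + 1) k", unfolded 2] by (rule subset_antisym)
  qed
  have 0: "0 \<in> spc C (n + 1)" "dif C (n + 1) 0 = 0"
    using fvs.subspace_0[OF subspace(1)] linear_on_0[OF subspace(1) lin(1)] by auto
  have self: "u \<in> homology_class C n u" for u
    using 0 unfolding homology_class_def boundaries_def by force
  have "homology_map D f n (homology_class C n u) = homology_class D n (f n u)" if "u \<in> cycles C n" for u
  proof -
    have "homology_class D n (f n v) = homology_class D n (f n u)" if v: "v \<in> homology_class C n u" for v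
    proof -
      obtain h where h: "h \<in> spc C (n + 1)" "v = u + dif C (n + 1) h"
        using v unfolding homology_class_def boundaries_def by blast
      have "dif C (n + 1) h \<in> spc C n"
        using C h(1) unfolding chain_complex_def by (metis add_diff_cancel_right')
      moreover have "u \<in> spc C n"
        using \<open>u \<in> cycles C n\<close> by (simp add: cycles_def)
      moreover have "f n (dif C (n + 1) h) = dif D (n + 1) (f (n + 1) h)" "f (n + 1) h \<in> spc D (n + 1)"
        using f(1) h(1) unfolding chain_map_def by (metis add_diff_cancel_right')+
      moreover have "linear_on (spc C n) (f n)"
        using f(1) unfolding chain_map_def by blast
      ultimately show ?thesis
        unfolding h(2) using shift by (simp only: linear_on_add)
    qed
    then show ?thesis
      using self[of u] unfolding homology_map_def by blast
  qed
  then have "homology_map D f n (homology_class C n z) = homology_map D f n (homology_class C n w)"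
    using z by simp
  moreover have "inj_on (homology_map D f n) (homology C n)"
    using f(2) unfolding quasi_iso_def bij_betw_def by blast
  ultimately have "homology_class C n z = homology_class C n w"
    using z(1,2) unfolding homology_def inj_on_def by blast
  then have "z \<in> homology_class C n w"
    using self[of z] by simp
  then show ?thesis
    using that unfolding homology_class_def boundaries_def by blast
qed


section \<open>The coalgebra of grouplike elements\<close>

definition supported :: "'u set \<Rightarrow> ('u \<Rightarrow> 'k::field) set" where
  "supported S = {v. \<forall>x. x \<notin> S \<longrightarrow> v x = 0}"

definition unit_vec :: "'u \<Rightarrow> 'u \<Rightarrow> 'k::field" where
  "unit_vec x = (\<lambda>y. if y = x then 1 else 0)"

text \<open>On finitely supported vectors, the linear map sending each basis vector to its tensor
  square.\<close>

definition diagonal :: "('u \<Rightarrow> 'k::field) \<Rightarrow> ('u \<times> 'u \<Rightarrow> 'k)" where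
  "diagonal v = (\<lambda>(x, y). if x = y then v x else 0)"

text \<open>For finite \<open>S\<close>, the coalgebra with basis \<open>S\<close> in degree 0 whose
  basis vectors are grouplike. The membership tests make the structure maps vanish outside their
  domains, as the normalization demands.\<close>

definition grouplike_coalgebra :: "'u set \<Rightarrow> ('u, 'k::field) coalgebra_data" where
  "grouplike_coalgebra S =
     \<lparr>spc = (\<lambda>n. if n = 0 then supported S else {0}),
      dif = (\<lambda>n v. 0),
      comul = (\<lambda>n v p q. if n = 0 \<and> p = 0 \<and> q = 0 \<and> v \<in> supported S then diagonal v else 0),
      counit = (\<lambda>v. if v \<in> supported S then sum v S else 0)\<rparr>"

lemma supported_subspace: "fvs.subspace (supported S)"
  by (simp add: fvs.subspace_def supported_def fscale_def)

lemma unit_vec_in: "x \<in> S \<Longrightarrow> unit_vec x \<in> supported S"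
  by (auto simp: supported_def unit_vec_def)

lemma sum_unit_vec: "finite S \<Longrightarrow> x \<in> S \<Longrightarrow> sum (unit_vec x) S = 1"
  by (simp add: unit_vec_def)

lemma diagonal_scale_unit_vec: "diagonal (fscale c (unit_vec x)) = tensor (fscale c (unit_vec x)) (unit_vec x)"
  by (auto simp: diagonal_def tensor_def unit_vec_def fscale_def fun_eq_iff)

lemma diagonal_unit_vec: "diagonal (unit_vec x) = tensor (unit_vec x) (unit_vec x)"
  by (auto simp: diagonal_def tensor_def unit_vec_def fun_eq_iff)

lemma diagonal_in:
  assumes "finite S" "v \<in> supported S"
  shows "diagonal v \<in> tensor_space (supported S) (supported S)"
proof -
  have "sum g S z = (\<Sum>x\<in>S. g x z)" for g :: "'a \<Rightarrow> 'a \<times> 'a \<Rightarrow> 'b" and z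
    by (induction S rule: infinite_finite_induct) simp_all
  then have "diagonal v = (\<Sum>x\<in>S. fscale (v x) (tensor (unit_vec x) (unit_vec x)))"
    using assms by (auto simp: diagonal_def tensor_def unit_vec_def fscale_def fun_eq_iff supported_def
        if_distrib[of "\<lambda>a. _ * a"] cong: if_cong)
  also have "\<dots> \<in> tensor_space (supported S) (supported S)"
    by (intro fvs.subspace_sum fvs.subspace_scale subspace_tensor_space tensor_in unit_vec_in)
  finally show ?thesis .
qed

text \<open>Adding a point adds one coordinate, and an infinite field is equipollent to its square.
  This provides the smallness required of a \<open>chain_complex\<close>.\<close>

lemma supported_lepoll:
  assumes "finite S" "infinite (UNIV :: 'k::field set)"
  shows "(supported S :: ('u \<Rightarrow> 'k) set) \<lesssim> (UNIV :: 'k set)"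
  using assms(1)
proof (induction rule: finite_induct)
  case empty
  have "supported {} = {0 :: 'u \<Rightarrow> 'k}"
    by (auto simp: supported_def)
  then show ?case
    using finite_lepoll_infinite[OF assms(2), of "{0 :: 'u \<Rightarrow> 'k}"] by simp
next
  case (insert x S)
  have "v \<in> (\<lambda>(c, w). w(x := c)) ` (UNIV \<times> supported S)" if "v \<in> supported (insert x S)" for v :: "'u \<Rightarrow> 'k"
  proof (rule image_eqI[of _ _ "(v x, v(x := 0))"])
    show "(v x, v(x := 0)) \<in> UNIV \<times> supported S"
      using that by (auto simp: supported_def)
  qed simp
  then have "(supported (insert x S) :: ('u \<Rightarrow> 'k) set) \<lesssim> (UNIV :: 'k set) \<times> (supported S :: ('u \<Rightarrow> 'k) set)"
    by (intro subset_image_lepoll subsetI)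
  also have "\<dots> \<lesssim> (UNIV :: 'k set) \<times> (UNIV :: 'k set)"
    using insert.IH by (intro times_lepoll_mono) simp_all
  also have "\<dots> \<lesssim> (UNIV :: 'k set)"
    using card_of_Times_same_infinite[OF assms(2)] eqpoll_iff_card_of_ordIso eqpoll_imp_lepoll by blast
  finally show ?case .
qed

lemma uC_coalgebra_grouplike:
  fixes S :: "'u set"
  assumes "finite S" "(supported S :: ('u \<Rightarrow> 'k::field) set) \<prec> (UNIV :: 'u set)"
  shows "uC_coalgebra (grouplike_coalgebra S :: ('u, 'k) coalgebra_data)"
proof -
  let ?K = "grouplike_coalgebra S :: ('u, 'k) coalgebra_data"
  have z: "(0 :: 'u \<Rightarrow> 'k) \<in> supported S"
    using fvs.subspace_0[OF supported_subspace] .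
  have d0: "diagonal (0 :: 'u \<Rightarrow> 'k) = 0"
    by (auto simp: diagonal_def fun_eq_iff)
  \<comment> \<open>These are the rows and columns of \<open>diagonal c\<close>; they must lie in
    \<open>supported S\<close> to pass the membership tests in \<open>comul\<close> and
    \<open>counit\<close>.\<close>
  have row: "(\<lambda>y. if x = y then c x else 0) \<in> supported S" "(\<lambda>y. if y = x then c y else 0) \<in> supported S"
    if "c \<in> supported S" for c :: "'u \<Rightarrow> 'k" and x
    using that by (auto simp: supported_def)
  have sum_row: "sum (\<lambda>y. if x = y then c x else 0) S = c x" "sum (\<lambda>y. if y = x then c y else 0) S = c x"
    if "c \<in> supported S" for c :: "'u \<Rightarrow> 'k" and x
    using that assms(1) by (auto simp: supported_def)
  have "{0 :: 'u \<Rightarrow> 'k} \<lesssim> (supported S :: ('u \<Rightarrow> 'k) set)"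
    using z by (intro subset_imp_lepoll) simp
  then have chain: "chain_complex ?K"
    using assms(2) lesspoll_trans1 z supported_subspace
    by (auto simp: chain_complex_def grouplike_coalgebra_def linear_on_def fscale_def zero_fun_def[symmetric]
        fvs.subspace_single_0)
  have lin: "linear_on (spc ?K n) (\<lambda>c. comul ?K n c p q)" for n p q
    by (simp add: linear_on_def grouplike_coalgebra_def z d0
          fvs.subspace_add[OF supported_subspace] fvs.subspace_scale[OF supported_subspace])
       (auto simp: diagonal_def fscale_def fun_eq_iff)
  have deg: "comul ?K n c \<in> tensor_deg ?K ?K n" if "c \<in> spc ?K n" for n c
  proof -
    have "{(p, q). comul ?K n c p q \<noteq> 0} \<subseteq> {(0, 0)}"
      by (auto simp: grouplike_coalgebra_def)
    then have "finite {(p, q). comul ?K n c p q \<noteq> 0}"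
      by (rule finite_subset) simp
    then show ?thesis
      using diagonal_in[OF assms(1)] fvs.subspace_0[OF subspace_tensor_space]
      unfolding tensor_deg_def by (auto simp: grouplike_coalgebra_def)
  qed
  have dif: "comul ?K (n - 1) (dif ?K n c) = tensor_dif ?K ?K (comul ?K n c)" for n c
    using z d0 by (simp add: grouplike_coalgebra_def tensor_dif_def map_left_def map_right_def
        fscale_def fun_eq_iff)
  have counit: "functional_on (spc ?K 0) (counit ?K)"
    by (simp add: functional_on_def grouplike_coalgebra_def sum.distrib
          fvs.subspace_add[OF supported_subspace] fvs.subspace_scale[OF supported_subspace])
       (simp add: fscale_def sum_distrib_left)
  have assoc: "reassoc (map_left (\<lambda>v. comul ?K (p + q) v p q) (comul ?K n c (p + q) r)) =
      map_right (\<lambda>v. comul ?K (q + r) v q r) (comul ?K n c p (q + r))" for n p q r c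
    using row[of c] z d0
    \<comment> \<open>If some degree is nonzero, both sides vanish; otherwise, for
      \<open>n = 0\<close> and \<open>c\<close> in \<open>supported S\<close>, both are
      \<open>c\<close> placed on the triple diagonal.\<close>
    by (cases "p = 0"; cases "q = 0"; cases "r = 0")
      (auto simp: grouplike_coalgebra_def reassoc_def map_left_def map_right_def fun_eq_iff diagonal_def
        zero_fun_def[symmetric])
  have counital: "contract_left (counit ?K) (comul ?K n c 0 n) = c \<and>
      contract_right (counit ?K) (comul ?K n c n 0) = c" if "c \<in> spc ?K n" for n c
    using that row[of c] sum_row[of c] z
    by (auto simp: grouplike_coalgebra_def contract_left_def contract_right_def diagonal_def
        zero_fun_def[symmetric] split: if_splits)
  have comm: "comul ?K n c q p = fscale (koszul (p * q)) (swap (comul ?K n c p q))" for n p q c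
    by (auto simp: grouplike_coalgebra_def koszul_def fscale_def swap_def diagonal_def fun_eq_iff)
  have "\<forall>c\<in>spc ?K 1. counit ?K (dif ?K 1 c) = 0"
    using z by (simp add: grouplike_coalgebra_def)
  with chain lin deg dif counit assoc counital comm show ?thesis
    unfolding uC_coalgebra_def by blast
qed

text \<open>The linear extension of the constant map from \<open>S\<close> to
  \<open>x\<close>.\<close>

definition collapse :: "'u set \<Rightarrow> 'u \<Rightarrow> int \<Rightarrow> ('u \<Rightarrow> 'k::field) \<Rightarrow> ('u \<Rightarrow> 'k)" where
  "collapse S x n v = (if n = 0 \<and> v \<in> supported S then fscale (sum v S) (unit_vec x) else 0)"

lemma collapse_linear: "linear_on (supported S) (collapse S x 0)"
  by (simp add: linear_on_def collapse_def sum.distrib fvs.subspace_add[OF supported_subspace]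
        fvs.subspace_scale[OF supported_subspace])
     (simp add: fscale_def sum_distrib_left fun_eq_iff algebra_simps)

lemma collapse_unit_vec: "finite S \<Longrightarrow> y \<in> S \<Longrightarrow> collapse S x 0 (unit_vec y) = unit_vec x"
  by (simp add: collapse_def unit_vec_in sum_unit_vec)

lemma coalgebra_map_collapse:
  fixes S :: "'u set"
  assumes "finite S" "x \<in> S"
  shows "coalgebra_map (grouplike_coalgebra S) (grouplike_coalgebra S :: ('u, 'k::field) coalgebra_data)
    (collapse S x)"
proof -
  let ?K = "grouplike_coalgebra S :: ('u, 'k) coalgebra_data"
  have z: "(0 :: 'u \<Rightarrow> 'k) \<in> supported S"
    using fvs.subspace_0[OF supported_subspace] .
  have c0: "collapse S x n (0 :: 'u \<Rightarrow> 'k) = 0" for n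
    by (simp add: collapse_def)
  have in_S: "collapse S x 0 v \<in> supported S" for v :: "'u \<Rightarrow> 'k"
    by (simp add: collapse_def z fvs.subspace_scale[OF supported_subspace unit_vec_in[OF assms(2)]])
  have "linear_on (spc ?K n) (collapse S x n)" for n
  proof (cases "n = 0")
    case True
    then show ?thesis
      using collapse_linear[of S x] by (simp add: grouplike_coalgebra_def)
  next
    case False
    then show ?thesis
      by (simp add: linear_on_def collapse_def)
  qed
  then have "chain_map ?K ?K (collapse S x)"
    using in_S c0 by (auto simp: chain_map_def grouplike_coalgebra_def)
  moreover have "comul ?K n (collapse S x n c) = tensor_map (collapse S x) (collapse S x) (comul ?K n c)"
    if c: "c \<in> spc ?K n" for n c
  proof (intro ext)
    fix p q and st :: "'u \<times> 'u"
    show "comul ?K n (collapse S x n c) p q st =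
      tensor_map (collapse S x) (collapse S x) (comul ?K n c) p q st"
    proof (cases "n = 0 \<and> p = 0 \<and> q = 0")
      case True
      then have cS: "c \<in> supported S"
        using c by (simp add: grouplike_coalgebra_def)
      \<comment> \<open>Row \<open>y\<close> of \<open>diagonal c\<close> has sum
        \<open>c y\<close>, so collapsing the right factor leaves \<open>c\<close> tensor
        \<open>unit_vec x\<close>. Collapsing the left factor then gives a multiple of a tensor
        square, which is again diagonal.\<close>
      have "(\<lambda>z. if y = z then c y else 0) \<in> supported S \<and> sum (\<lambda>z. if y = z then c y else 0) S = c y" for y
        using cS assms(1) by (auto simp: supported_def)
      then have "map_right (collapse S x 0) (diagonal c) = tensor c (unit_vec x)"
        by (simp add: map_right_def diagonal_def collapse_def tensor_def fscale_def)
      then have "map_left (collapse S x 0) (map_right (collapse S x 0) (diagonal c)) =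
          tensor (collapse S x 0 c) (unit_vec x)"
        using map_left_tensor[OF collapse_linear cS] by simp
      also have "\<dots> = diagonal (collapse S x 0 c)"
        using cS by (simp add: collapse_def diagonal_scale_unit_vec)
      finally show ?thesis
        using True cS in_S by (simp add: tensor_map_def grouplike_coalgebra_def)
    next
      case False
      then show ?thesis
        using c0 by (auto simp: tensor_map_def grouplike_coalgebra_def map_left_def map_right_def
            zero_fun_def[symmetric] split: prod.splits)
    qed
  qed
  moreover have "counit ?K (collapse S x 0 c) = counit ?K c" if c: "c \<in> spc ?K 0" for c
  proof -
    have "sum (collapse S x 0 c) S = sum c S * sum (unit_vec x) S"
      using c by (simp add: collapse_def grouplike_coalgebra_def fscale_def sum_distrib_left)
    then show ?thesis
      using c in_S assms by (simp add: grouplike_coalgebra_def sum_unit_vec)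
  qed
  ultimately show ?thesis
    unfolding coalgebra_map_def by blast
qed


section \<open>Failure of the factorization axiom\<close>

theorem mainTheorem6:
  assumes "(UNIV :: 'k::{alg_closed_field, field_char_0} set) \<prec> (UNIV :: 'u set)"
  shows "\<not> coadmissible
    (uC_Coalg :: (('u, 'k) coalgebra_data, (('u, 'k) coalgebra_data, int \<Rightarrow> ('u \<Rightarrow> 'k) \<Rightarrow> ('u \<Rightarrow> 'k)) arrow) cat)"
proof
  let ?A = "uC_Coalg :: (('u, 'k) coalgebra_data, (('u, 'k) coalgebra_data, int \<Rightarrow> ('u \<Rightarrow> 'k) \<Rightarrow> ('u \<Rightarrow> 'k)) arrow) cat"
  assume "coadmissible ?A"
  then have fact: "factorizes ?A (cofibrations ?A) (fibrations ?A \<inter> weak_equivalences ?A)"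
    unfolding coadmissible_def model_category_def by (elim conjE)
  \<comment> \<open>Characteristic zero makes the field infinite. This gives two distinct points of
    \<open>'u\<close> and bounds the size of the spaces of \<open>?K\<close>.\<close>
  have inf_k: "infinite (UNIV :: 'k set)"
    using finite_subset[OF subset_UNIV, of "range (of_nat :: nat \<Rightarrow> 'k)"]
    by (auto simp: finite_image_iff inj_of_nat)
  then have "infinite (UNIV :: 'u set)"
    using assms unfolding lesspoll_def lepoll_def by (metis finite_imageD finite_subset)
  then obtain x y :: 'u where "x \<noteq> y"
    by (metis (full_types) ex_new_if_finite finite.emptyI finite.insertI insertCI)
  define S where "S = {x, y}"
  then have S: "finite S" "x \<in> S" "y \<in> S"
    by simp_all
  let ?K = "grouplike_coalgebra S :: ('u, 'k) coalgebra_data"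
  have K: "uC_coalgebra ?K"
    using uC_coalgebra_grouplike[OF S(1)] lesspoll_trans1[OF supported_lepoll[OF S(1) inf_k] assms] .
  \<comment> \<open>Using \<open>?K\<close> as target too avoids constructing a second
    coalgebra.\<close>
  define F :: "(('u, 'k) coalgebra_data, int \<Rightarrow> ('u \<Rightarrow> 'k) \<Rightarrow> ('u \<Rightarrow> 'k)) arrow"
    where "F = \<lparr>src = ?K, fn = collapse S x, trg = ?K\<rparr>"
  have "F \<in> arr ?A"
    using K coalgebra_map_collapse[OF S(1,2)] by (simp add: F_def uC_Coalg_def)
  then obtain i p where ip: "i \<in> cofibrations ?A" "p \<in> weak_equivalences ?A"
    "cod ?A i = dom ?A p" "comp ?A p i = F"
    using fact unfolding factorizes_def by blast
  define I where "I = trg i"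
  have src: "src i = ?K" "src p = I" "trg p = ?K" and fn: "fn p n (fn i n v) = collapse S x n v" for n v
    using ip(3,4) by (auto simp: uC_Coalg_def F_def I_def dest: fun_cong)
  have I: "uC_coalgebra I" and i: "coalgebra_map ?K I (fn i)" "inj_on (fn i 0) (spc ?K 0)"
    and p: "coalgebra_map I ?K (fn p)" "quasi_iso I ?K (fn p)"
    using ip(1,2) src by (simp_all add: cofibrations_def weak_equivalences_def uC_Coalg_def I_def)
  have i_chain: "chain_map ?K I (fn i)" and p_chain: "chain_map I ?K (fn p)"
    using i(1) p(1) by (simp_all add: coalgebra_map_def)
  have lin: "linear_on (supported S) (fn i 0)"
    using i_chain unfolding chain_map_def grouplike_coalgebra_def by (auto dest: spec[of _ 0])
  \<comment> \<open>Coalgebra maps preserve grouplike elements, and the images are cycles because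
    the differential of \<open>?K\<close> is zero.\<close>
  have grouplike: "fn i 0 (unit_vec z) \<in> cycles I 0"
    "comul I 0 (fn i 0 (unit_vec z)) 0 0 = tensor (fn i 0 (unit_vec z)) (fn i 0 (unit_vec z))"
    "counit I (fn i 0 (unit_vec z)) = 1" if z: "z \<in> S" for z
  proof -
    have zK: "unit_vec z \<in> spc ?K 0"
      using unit_vec_in[OF z] by (simp add: grouplike_coalgebra_def)
    have "fn i (- 1) 0 = 0"
      using linear_on_0[OF uC_coalgebraD(1)[OF K]] i_chain unfolding chain_map_def by blast
    then show "fn i 0 (unit_vec z) \<in> cycles I 0"
      using i_chain zK unfolding chain_map_def cycles_def
      by (auto simp: grouplike_coalgebra_def dest!: spec[of _ 0] bspec[of _ _ "unit_vec z"])
    have "comul ?K 0 (unit_vec z) 0 0 = tensor (unit_vec z) (unit_vec z)"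
      by (simp add: grouplike_coalgebra_def diagonal_unit_vec unit_vec_in[OF z])
    then have "tensor_map (fn i) (fn i) (comul ?K 0 (unit_vec z)) 0 0 =
        tensor (fn i 0 (unit_vec z)) (fn i 0 (unit_vec z))"
      by (simp add: tensor_map_def map_left_tensor[OF lin] map_right_tensor[OF lin] unit_vec_in[OF z])
    then show "comul I 0 (fn i 0 (unit_vec z)) 0 0 = tensor (fn i 0 (unit_vec z)) (fn i 0 (unit_vec z))"
      using i(1) zK by (simp add: coalgebra_map_def)
    show "counit I (fn i 0 (unit_vec z)) = 1"
      using i(1) zK
      by (simp add: coalgebra_map_def)
         (simp add: grouplike_coalgebra_def unit_vec_in[OF z] sum_unit_vec[OF S(1) z])
  qed
  have chain: "chain_complex I" "chain_complex ?K"
    by (rule I[unfolded uC_coalgebra_def, THEN conjunct1] K[unfolded uC_coalgebra_def, THEN conjunct1])+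
  \<comment> \<open>Since \<open>p\<close> identifies the two images and is injective on homology,
    they are homologous, hence equal by rigidity; this contradicts the injectivity of
    \<open>i\<close>.\<close>
  have "fn p 0 (fn i 0 (unit_vec x)) = fn p 0 (fn i 0 (unit_vec y))"
    by (simp only: fn collapse_unit_vec[OF S(1,2)] collapse_unit_vec[OF S(1,3)])
  then obtain h where h: "h \<in> spc I 1" "fn i 0 (unit_vec x) = fn i 0 (unit_vec y) + dif I 1 h"
    using quasi_iso_inj[OF chain p_chain p(2) grouplike(1)[OF S(2)] grouplike(1)[OF S(3)]] by auto
  then have "fn i 0 (unit_vec x) = fn i 0 (unit_vec y)"
    using grouplike(1)[OF S(2)] grouplike(1)[OF S(3)]
    by (intro homologous_grouplike_eq[OF I _ grouplike(2,3)[OF S(2)] _ grouplike(2,3)[OF S(3)] h])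
       (simp_all add: cycles_def)
  then have "unit_vec x = (unit_vec y :: 'u \<Rightarrow> 'k)"
    using inj_onD[OF i(2)] by (simp add: grouplike_coalgebra_def unit_vec_in[OF S(2)] unit_vec_in[OF S(3)])
  then show False
    using \<open>x \<noteq> y\<close> by (metis unit_vec_def zero_neq_one)
qed

end
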